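(* For $d\in\mathbb N$ let $\rho_d$ be the value of the semidefinite program $$\rho_d=\sup\int_{\mathcal Q}w_d(q)\,dq$$ over $w_d\in\mathbb R[q]_{2d}$, $\sigma_0,\sigma_{x_1},\dots,\sigma_{x_{m-1}}\in\Sigma[q,x,\tilde y]_{2d}$, $\sigma_1,\dots,\sigma_n\in\Sigma[q,x,\tilde y]_{2d-2}$, $\tau_{\Re,k},\tau_{\Im,k}\in\mathbb R[q,x,\tilde y]_{2d-k}$ ($k=1,\dots,m$), subject to the polynomial identity $$x_m-w_d(q)=\sigma_0+\sum_{j=1}^n\sigma_j(1-q_j^2)+\sum_{k=1}^{m-1}\sigma_{x_k}(x_m-x_k)+\sum_{k=1}^m\tau_{\Re,k}\big((-1)^kp_{m-k}(q)-R_k\big)+\sum_{k=1}^m\tau_{\Im,k}I_k .$$ Let $d_0$ be such that the program is feasible for all $d\ge d_0$, and for $d\ge d_0$ let $w_d$ be a near optimal solution, i.e. feasible with $\int_{\mathcal Q}w_d(q)\,dq\ge\rho_d-\frac1d$. Then $w_d\le a$ on $\mathcal Q$ and $w_d$ converges to the abscissa $a$ in $L^1(\mathcal Q)$ norm.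
   Context: Let $n\ge1$, $\mathcal Q=[-1,1]^n$, $dq$ Lebesgue measure. Let $m\ge1$ and $p(q,s)=\sum_{k=0}^m p_k(q)s^k$ with $p_k\in\mathbb R[q]$, $p_m\equiv1$; the abscissa is $a(q)=\max\{\Re(s):p(q,s)=0\}$. Variables: $x=(x_1,\dots,x_m)\in\mathbb R^m$ and "free imaginary variables" $\tilde y$: if $m$ is even, $\tilde y=(y_2,y_4,\dots,y_m)$ and one sets $y_{2j-1}:=-y_{2j}$; if $m\ge3$ is odd, $\tilde y=(y_2,y_4,\dots,y_{m-1},y_m)$ and one sets $y_{2j-1}:=-y_{2j}$ for $j=1,\dots,\frac{m-3}{2}$ and $y_{m-2}:=-y_{m-1}-y_m$; if $m=1$, $\tilde y=(y_1)$. Put $s_k=x_k+iy_k$, let $e_k(s_1,\dots,s_m)=\sum_{1\le l_1<\dots<l_k\le m}s_{l_1}\cdots s_{l_k}$, and let $R_k,I_k$ be the real polynomials in $(x,\tilde y)$ with $e_k=R_k+iI_k$. $\mathbb R[z]_k$ denotes polynomials of degree at most $k$ and $\Sigma[z]_{2k}$ sums of squares of polynomials of degree at most $2k$ (with $\mathbb R[z]_k=\{0\}$ if $k<0$). *)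

theory Defs
  imports "HOL-Analysis.Analysis"
begin

text \<open>Multivariate real polynomials are represented as polynomial functions
on points z :: nat => real, using only the coordinates z 0, ..., z (N-1).
poly_fun N k f: f is a polynomial in N variables of total degree at most k
(k an integer; for k < 0 only the zero polynomial).\<close>

definition mono_set :: "nat \<Rightarrow> int \<Rightarrow> (nat \<Rightarrow> nat) set" where
  "mono_set N k = {\<alpha>. (\<forall>i\<ge>N. \<alpha> i = 0) \<and> int (sum \<alpha> {..<N}) \<le> k}"

definition poly_fun :: "nat \<Rightarrow> int \<Rightarrow> ((nat \<Rightarrow> real) \<Rightarrow> real) \<Rightarrow> bool" where
  "poly_fun N k f \<longleftrightarrow> (\<exists>c :: (nat \<Rightarrow> nat) \<Rightarrow> real.
      \<forall>z. f z = (\<Sum>\<alpha>\<in>mono_set N k. c \<alpha> * (\<Prod>i<N. z i ^ \<alpha> i)))"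

definition sos :: "nat \<Rightarrow> int \<Rightarrow> ((nat \<Rightarrow> real) \<Rightarrow> real) \<Rightarrow> bool" where
  "sos N k f \<longleftrightarrow> (\<exists>gs. (\<forall>g\<in>set gs. poly_fun N k g) \<and>
      (\<forall>z. f z = (\<Sum>g\<leftarrow>gs. (g z)^2)))"

definition abscissa :: "nat \<Rightarrow> (nat \<Rightarrow> (nat \<Rightarrow> real) \<Rightarrow> real) \<Rightarrow> (nat \<Rightarrow> real) \<Rightarrow> real" where
  "abscissa m p q = Max {Re s | s. (\<Sum>k\<le>m. complex_of_real (p k q) * s ^ k) = 0}"

text \<open>Number of free imaginary variables: ceil(m/2).\<close>
definition nfree :: "nat \<Rightarrow> nat" where
  "nfree m = (m + 1) div 2"

text \<open>yfull m yt k = y_k (k = 1..m) in terms of the free imaginary variables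
yt 0, ..., yt (nfree m - 1) (listed in the order of tilde y).\<close>
definition yfull :: "nat \<Rightarrow> (nat \<Rightarrow> real) \<Rightarrow> nat \<Rightarrow> real" where
  "yfull m yt k =
    (if even m then (if even k then yt (k div 2 - 1) else - yt ((k + 1) div 2 - 1))
     else if m = 1 then yt 0
     else (if k = m then yt ((m - 1) div 2)
           else if even k then yt (k div 2 - 1)
           else if k = m - 2 then - yt ((m - 1) div 2 - 1) - yt ((m - 1) div 2)
           else - yt ((k + 1) div 2 - 1)))"

text \<open>Variable layout of a point z in (q, x, tilde y):
q_j = z (j-1) (j = 1..n), x_k = z (n+k-1) (k = 1..m), tilde y_j = z (n+m+j).\<close>
definition svar :: "nat \<Rightarrow> nat \<Rightarrow> (nat \<Rightarrow> real) \<Rightarrow> nat \<Rightarrow> complex" where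
  "svar n m z l = Complex (z (n + l - 1)) (yfull m (\<lambda>j. z (n + m + j)) l)"

definition esym :: "nat \<Rightarrow> nat \<Rightarrow> nat \<Rightarrow> (nat \<Rightarrow> real) \<Rightarrow> complex" where
  "esym n m k z = (\<Sum>S\<in>{S. S \<subseteq> {1..m} \<and> card S = k}. \<Prod>l\<in>S. svar n m z l)"

definition Rk :: "nat \<Rightarrow> nat \<Rightarrow> nat \<Rightarrow> (nat \<Rightarrow> real) \<Rightarrow> real" where
  "Rk n m k z = Re (esym n m k z)"

definition Ik :: "nat \<Rightarrow> nat \<Rightarrow> nat \<Rightarrow> (nat \<Rightarrow> real) \<Rightarrow> real" where
  "Ik n m k z = Im (esym n m k z)"

definition feasible :: "nat \<Rightarrow> nat \<Rightarrow> (nat \<Rightarrow> (nat \<Rightarrow> real) \<Rightarrow> real) \<Rightarrow> nat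
    \<Rightarrow> ((nat \<Rightarrow> real) \<Rightarrow> real) \<Rightarrow> bool" where
  "feasible n m p d w \<longleftrightarrow> poly_fun n (2 * int d) w \<and>
    (\<exists>\<sigma>0 \<sigma> \<sigma>x \<tau>R \<tau>I.
       sos (n + m + nfree m) (int d) \<sigma>0 \<and>
       (\<forall>j\<in>{1..n}. sos (n + m + nfree m) (int d - 1) (\<sigma> j)) \<and>
       (\<forall>k\<in>{1..m-1}. sos (n + m + nfree m) (int d) (\<sigma>x k)) \<and>
       (\<forall>k\<in>{1..m}. poly_fun (n + m + nfree m) (2 * int d - int k) (\<tau>R k) \<and>
                   poly_fun (n + m + nfree m) (2 * int d - int k) (\<tau>I k)) \<and>
       (\<forall>z. z (n + m - 1) - w z =
           \<sigma>0 z
         + (\<Sum>j\<in>{1..n}. \<sigma> j z * (1 - (z (j - 1))^2))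
         + (\<Sum>k\<in>{1..m-1}. \<sigma>x k z * (z (n + m - 1) - z (n + k - 1)))
         + (\<Sum>k\<in>{1..m}. \<tau>R k z * ((-1)^k * p (m - k) z - Rk n m k z))
         + (\<Sum>k\<in>{1..m}. \<tau>I k z * Ik n m k z)))"

definition Leb :: "nat \<Rightarrow> (nat \<Rightarrow> real) measure" where
  "Leb n = PiM {..<n} (\<lambda>_. lborel)"

definition Qbox :: "nat \<Rightarrow> (nat \<Rightarrow> real) set" where
  "Qbox n = PiE {..<n} (\<lambda>_. {-1..1})"

definition rho :: "nat \<Rightarrow> nat \<Rightarrow> (nat \<Rightarrow> (nat \<Rightarrow> real) \<Rightarrow> real) \<Rightarrow> nat \<Rightarrow> real" where
  "rho n m p d = Sup {(LINT q:Qbox n|Leb n. w q) | w. feasible n m p d w}"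

end

theory Submission
  imports Defs "HOL-Computational_Algebra.Fundamental_Theorem_Algebra"
begin

text \<open>
  The constraints of the program describe the set \<open>K\<close> of triples \<open>(q, x, y)\<close> with \<open>q\<close> in the box and
  \<open>x\<^sub>1 + i y\<^sub>1, \<dots>, x\<^sub>m + i y\<^sub>m\<close> the roots of \<open>p(q, \<cdot>)\<close> listed with \<open>x\<^sub>m\<close> maximal. On \<open>K\<close> the
  coordinate \<open>x\<^sub>m\<close> is therefore the abscissa \<open>a(q)\<close>, and \<open>K\<close> projects onto the box because the roots
  of a real polynomial can be paired as the relations between the \<open>y\<^sub>k\<close> demand. Hence \<open>w \<le> a\<close> for
  every feasible \<open>w\<close>. Since \<open>K\<close> is compact (up to irrelevant coordinates), \<open>a\<close> is continuous.

  The quadratic module of the program is Archimedean: each root satisfies a monic equation whose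
  coefficients are polynomials in the bounded variables \<open>q\<close>, and the usual root bound has a
  sum of squares proof. By Putinar's Positivstellensatz every polynomial \<open>w < a\<close> is thus feasible
  for all large \<open>d\<close>. The Stone--Weierstrass theorem provides such \<open>w\<close> uniformly close to \<open>a\<close>, so
  \<open>\<rho>\<^sub>d\<close> tends to the integral of \<open>a\<close>, and \<open>w\<^sub>d \<le> a\<close> turns convergence of integrals into
  \<open>L\<^sup>1\<close> convergence.

  Putinar's theorem is proved algebraically. If \<open>-1 \<notin> M - f \<Sigma>\<close>, a maximal proper quadratic module
  above \<open>M - f \<Sigma>\<close> is total, and \<open>a \<mapsto> sup {r. a - r \<in> S}\<close> is a character that is nonnegative on \<open>M\<close>
  but not positive at \<open>f\<close>. Otherwise \<open>s f - 1 \<in> M\<close> for a sum of squares \<open>s\<close>, and the identity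
  \<open>N\<^sup>2 (f + r) = (N - s)\<^sup>2 (f + r) + s (2 N - s) (f + r)\<close> lets one lower \<open>r\<close> in \<open>f + r \<in> M\<close>
  by fixed steps until \<open>r = 0\<close>.
\<close>

section \<open>Quadratic modules and Putinar's theorem\<close>

locale function_algebra =
  fixes A :: "('z \<Rightarrow> real) set"
  assumes const: "(\<lambda>_. c) \<in> A"
    and add: "f \<in> A \<Longrightarrow> g \<in> A \<Longrightarrow> (\<lambda>z. f z + g z) \<in> A"
    and mult: "f \<in> A \<Longrightarrow> g \<in> A \<Longrightarrow> (\<lambda>z. f z * g z) \<in> A"
begin

lemma scale: "f \<in> A \<Longrightarrow> (\<lambda>z. c * f z) \<in> A"
  by (rule mult[OF const])

lemma minus: "f \<in> A \<Longrightarrow> (\<lambda>z. - f z) \<in> A"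
  using scale[of f "-1"] by simp

lemma diff: "f \<in> A \<Longrightarrow> g \<in> A \<Longrightarrow> (\<lambda>z. f z - g z) \<in> A"
  using add[OF _ minus, of f g] by simp

lemma power: "f \<in> A \<Longrightarrow> (\<lambda>z. f z ^ k) \<in> A"
  by (induction k) (simp_all add: const mult)

lemma sum: "(\<And>i. i \<in> I \<Longrightarrow> f i \<in> A) \<Longrightarrow> (\<lambda>z. \<Sum>i\<in>I. f i z) \<in> A"
  by (induction I rule: infinite_finite_induct) (simp_all add: const add)

lemma prod: "(\<And>i. i \<in> I \<Longrightarrow> f i \<in> A) \<Longrightarrow> (\<lambda>z. \<Prod>i\<in>I. f i z) \<in> A"
  by (induction I rule: infinite_finite_induct) (simp_all add: const mult)

lemmas closed = const add mult scale minus diff power sum prod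

inductive_set SOS :: "('z \<Rightarrow> real) set" where
  square: "g \<in> A \<Longrightarrow> (\<lambda>z. (g z)\<^sup>2) \<in> SOS"
| plus: "s \<in> SOS \<Longrightarrow> t \<in> SOS \<Longrightarrow> (\<lambda>z. s z + t z) \<in> SOS"

lemma SOS_in_A: "s \<in> SOS \<Longrightarrow> s \<in> A"
  by (induction rule: SOS.induct) (auto intro: closed)

lemma SOS_zero: "(\<lambda>_. 0) \<in> SOS"
  using square[OF const[of 0]] by simp

lemma SOS_square_mult: "s \<in> SOS \<Longrightarrow> g \<in> A \<Longrightarrow> (\<lambda>z. (g z)\<^sup>2 * s z) \<in> SOS"
proof (induction rule: SOS.induct)
  case (square h)
  then show ?case using SOS.square[OF mult[of g h]] by (simp add: power_mult_distrib)
next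
  case (plus s t)
  then show ?case using SOS.plus[of "\<lambda>z. (g z)\<^sup>2 * s z" "\<lambda>z. (g z)\<^sup>2 * t z"] by (simp add: distrib_left)
qed

section \<open>Quadratic modules\<close>

definition quadratic_module :: "('z \<Rightarrow> real) set \<Rightarrow> bool" where
  "quadratic_module M \<longleftrightarrow> (\<lambda>_. 1) \<in> M \<and> (\<forall>f\<in>M. \<forall>g\<in>M. (\<lambda>z. f z + g z) \<in> M) \<and>
     (\<forall>g\<in>A. \<forall>f\<in>M. (\<lambda>z. (g z)\<^sup>2 * f z) \<in> M)"

lemma qm_one: "quadratic_module M \<Longrightarrow> (\<lambda>_. 1) \<in> M"
  and qm_add: "quadratic_module M \<Longrightarrow> f \<in> M \<Longrightarrow> g \<in> M \<Longrightarrow> (\<lambda>z. f z + g z) \<in> M"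
  and qm_square_mult: "quadratic_module M \<Longrightarrow> h \<in> A \<Longrightarrow> f \<in> M \<Longrightarrow> (\<lambda>z. (h z)\<^sup>2 * f z) \<in> M"
  by (auto simp: quadratic_module_def)

lemma qm_scale:
  assumes "quadratic_module M" "f \<in> M" "c \<ge> 0"
  shows "(\<lambda>z. c * f z) \<in> M"
  using qm_square_mult[OF assms(1) const[of "sqrt c"] assms(2)] assms(3) by simp

lemma qm_const: "quadratic_module M \<Longrightarrow> c \<ge> 0 \<Longrightarrow> (\<lambda>_. c) \<in> M"
  using qm_scale[OF _ qm_one, of M c] by simp

lemma qm_sum:
  "quadratic_module M \<Longrightarrow> (\<And>i. i \<in> I \<Longrightarrow> f i \<in> M) \<Longrightarrow> (\<lambda>z. \<Sum>i\<in>I. f i z) \<in> M"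
  by (induction I rule: infinite_finite_induct) (simp_all add: qm_const qm_add)

lemma qm_square: "quadratic_module M \<Longrightarrow> g \<in> A \<Longrightarrow> (\<lambda>z. (g z)\<^sup>2) \<in> M"
  using qm_square_mult[OF _ _ qm_one, of M g] by simp

lemma qm_SOS_mult:
  assumes "quadratic_module M" "s \<in> SOS" "f \<in> M"
  shows "(\<lambda>z. s z * f z) \<in> M"
  using assms(2)
proof (induction rule: SOS.induct)
  case (square g)
  then show ?case using assms by (auto intro: qm_square_mult)
next
  case (plus s t)
  then show ?case using qm_add[OF assms(1)] by (fastforce simp: distrib_right)
qed

lemma qm_SOS: "quadratic_module M \<Longrightarrow> s \<in> SOS \<Longrightarrow> s \<in> M"
  using qm_SOS_mult[OF _ _ qm_one, of M s] by simp

text \<open>Most membership proofs below end with this rule: first comes a combination that visibly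
  lies in the module, then a pointwise identity of reals that rewrites it.\<close>

lemma qm_cong: "f \<in> M \<Longrightarrow> (\<And>z. f z = g z) \<Longrightarrow> g \<in> M"
  using ext[of f g] by simp

text \<open>A factor \<open>g\<close> of arbitrary sign is a difference of squares,
  \<open>g = ((g + 1) / 2)^2 - ((g - 1) / 2)^2\<close>. Hence the elements lying in \<open>M\<close>
  together with their negatives absorb multiplication by \<open>A\<close>.\<close>

lemma qm_ideal:
  assumes M: "quadratic_module M" and f: "f \<in> M" "(\<lambda>z. - f z) \<in> M" and g: "g \<in> A"
  shows "(\<lambda>z. g z * f z) \<in> M"
proof (rule qm_cong)
  show "(\<lambda>z. ((g z + 1) / 2)\<^sup>2 * f z + ((g z - 1) / 2)\<^sup>2 * (- f z)) \<in> M"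
    unfolding divide_inverse by (intro qm_add[OF M] qm_square_mult[OF M] f closed g)
  show "((g z + 1) / 2)\<^sup>2 * f z + ((g z - 1) / 2)\<^sup>2 * (- f z) = g z * f z" for z
    by (simp add: power2_eq_square field_simps)
qed

text \<open>For a quadratic module \<open>M\<close> this is the quadratic module generated by
  \<open>M\<close> and \<open>f\<close>.\<close>

definition adjoin :: "('z \<Rightarrow> real) set \<Rightarrow> ('z \<Rightarrow> real) \<Rightarrow> ('z \<Rightarrow> real) set" where
  "adjoin M f = {(\<lambda>z. h z + s z * f z) | h s. h \<in> M \<and> s \<in> SOS}"

lemma adjoinI: "h \<in> M \<Longrightarrow> s \<in> SOS \<Longrightarrow> (\<lambda>z. h z + s z * f z) \<in> adjoin M f"
  by (auto simp: adjoin_def)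

lemma adjoin_superset: "M \<subseteq> adjoin M f"
  using adjoinI[OF _ SOS_zero, of _ M f] by auto

lemma adjoin_mem: "quadratic_module M \<Longrightarrow> f \<in> adjoin M f"
  using adjoinI[OF qm_const[of M 0] square[OF const[of 1]], of f] by simp

lemma adjoin_qm:
  assumes M: "quadratic_module M"
  shows "quadratic_module (adjoin M f)"
  unfolding quadratic_module_def
proof (intro conjI ballI)
  show "(\<lambda>_. 1) \<in> adjoin M f" using adjoin_superset qm_one[OF M] by blast
next
  fix a b assume "a \<in> adjoin M f" "b \<in> adjoin M f"
  then obtain h s h' s' where *: "h \<in> M" "s \<in> SOS" "h' \<in> M" "s' \<in> SOS"
    "a = (\<lambda>z. h z + s z * f z)" "b = (\<lambda>z. h' z + s' z * f z)" by (auto simp: adjoin_def)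
  have "(\<lambda>z. (h z + h' z) + (s z + s' z) * f z) \<in> adjoin M f"
    using * by (intro adjoinI qm_add[OF M] plus)
  then show "(\<lambda>z. a z + b z) \<in> adjoin M f"
    by (rule qm_cong) (simp add: * algebra_simps)
next
  fix g a assume g: "g \<in> A" and "a \<in> adjoin M f"
  then obtain h s where *: "h \<in> M" "s \<in> SOS" "a = (\<lambda>z. h z + s z * f z)" by (auto simp: adjoin_def)
  have "(\<lambda>z. (g z)\<^sup>2 * h z + ((g z)\<^sup>2 * s z) * f z) \<in> adjoin M f"
    using * g by (intro adjoinI qm_square_mult[OF M] SOS_square_mult)
  then show "(\<lambda>z. (g z)\<^sup>2 * a z) \<in> adjoin M f"
    by (rule qm_cong) (simp add: * algebra_simps)
qed

text \<open>Zorn's lemma applies because properness is the absence of \<open>-1\<close>, which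
  survives unions of chains. If a maximal \<open>S\<close> omitted both \<open>a\<close> and
  \<open>- a\<close>, adjoining either one would produce \<open>-1\<close>, and combining the two
  representations would already produce \<open>-1\<close> in \<open>S\<close>.\<close>

lemma maximal_proper_qm:
  assumes M: "quadratic_module M" and proper: "(\<lambda>_. -1) \<notin> M"
  obtains S where "quadratic_module S" "M \<subseteq> S" "(\<lambda>_. -1) \<notin> S"
    "\<And>a. a \<in> A \<Longrightarrow> a \<in> S \<or> (\<lambda>z. - a z) \<in> S"
proof -
  define Q where "Q = {S. quadratic_module S \<and> M \<subseteq> S \<and> (\<lambda>_. -1) \<notin> S}"
  have "\<exists>S\<in>Q. \<forall>X\<in>Q. S \<subseteq> X \<longrightarrow> X = S"
  proof (rule subset_Zorn_nonempty)
    show "Q \<noteq> {}" using assms by (auto simp: Q_def)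
    fix C assume "C \<noteq> {}" and ch: "subset.chain Q C"
    then have CQ: "\<And>S. S \<in> C \<Longrightarrow> quadratic_module S \<and> M \<subseteq> S \<and> (\<lambda>_. -1) \<notin> S"
      and tot: "\<And>S T. S \<in> C \<Longrightarrow> T \<in> C \<Longrightarrow> S \<subseteq> T \<or> T \<subseteq> S"
      by (auto simp: subset.chain_def Q_def)
    obtain S0 where S0: "S0 \<in> C" using \<open>C \<noteq> {}\<close> by auto
    have "quadratic_module (\<Union>C)"
      unfolding quadratic_module_def
    proof (intro conjI ballI)
      show "(\<lambda>_. 1) \<in> \<Union>C" using S0 CQ qm_one by blast
    next
      fix f g assume "f \<in> \<Union>C" "g \<in> \<Union>C"
      then obtain S T where "S \<in> C" "T \<in> C" "f \<in> S" "g \<in> T" by auto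
      then obtain U where "U \<in> C" "f \<in> U" "g \<in> U" using tot[of S T] by auto
      then show "(\<lambda>z. f z + g z) \<in> \<Union>C" using CQ qm_add by blast
    next
      fix g f assume "g \<in> A" "f \<in> \<Union>C"
      then show "(\<lambda>z. (g z)\<^sup>2 * f z) \<in> \<Union>C" using CQ qm_square_mult by blast
    qed
    then show "\<Union>C \<in> Q" using CQ S0 by (auto simp: Q_def)
  qed
  then obtain S where S: "quadratic_module S" "M \<subseteq> S" "(\<lambda>_. -1) \<notin> S"
    and max: "\<And>X. X \<in> Q \<Longrightarrow> S \<subseteq> X \<Longrightarrow> X = S" by (auto simp: Q_def)
  have adj: "\<exists>h\<in>S. \<exists>s\<in>SOS. \<forall>z. -1 = h z + s z * a z" if "a \<notin> S" for a
  proof -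
    have "adjoin S a \<notin> Q" using max[of "adjoin S a"] adjoin_superset[of S a] adjoin_mem[OF S(1), of a] that by auto
    then have "(\<lambda>_. -1) \<in> adjoin S a" using adjoin_qm[OF S(1)] S(2) adjoin_superset[of S a] by (auto simp: Q_def)
    then show ?thesis by (auto simp: adjoin_def fun_eq_iff)
  qed
  have "a \<in> S \<or> (\<lambda>z. - a z) \<in> S" if a: "a \<in> A" for a
  proof (rule ccontr)
    assume "\<not> ?thesis"
    then have *: "a \<notin> S" "(\<lambda>z. - a z) \<notin> S" by blast+
    obtain h1 s1 where h1: "h1 \<in> S" "s1 \<in> SOS" and e1: "\<forall>z. -1 = h1 z + s1 z * a z"
      using adj[OF *(1)] by (elim bexE) (rule that)
    obtain h2 s2 where h2: "h2 \<in> S" "s2 \<in> SOS" and e2: "\<forall>z. -1 = h2 z + s2 z * (- a z)"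
      using adj[OF *(2)] by (elim bexE) (rule that)
    note h = h1 h2
    \<comment> \<open>Adding \<open>s2\<close> times \<open>e1\<close> to \<open>s1\<close> times
      \<open>e2\<close> cancels \<open>a\<close> and shows that this element equals
      \<open>- s1\<close>. So \<open>s1\<close> and \<open>- s1\<close> both lie in
      \<open>S\<close>, hence \<open>a * s1\<close> does, and \<open>e1\<close> puts
      \<open>-1\<close> into \<open>S\<close>.\<close>
    have "(\<lambda>z. s2 z + (s2 z * h1 z + s1 z * h2 z)) \<in> S"
      using qm_SOS[OF S(1) h(4)] h by (intro qm_add[OF S(1)] qm_SOS_mult[OF S(1)])
    then have "(\<lambda>z. - s1 z) \<in> S"
    proof (rule qm_cong)
      fix z
      have "s2 z * (-1 - h1 z) = s1 z * (1 + h2 z)"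
        using e1[rule_format, of z] e2[rule_format, of z] by algebra
      then show "s2 z + (s2 z * h1 z + s1 z * h2 z) = - s1 z" by (simp add: algebra_simps)
    qed
    then have "(\<lambda>z. a z * s1 z) \<in> S" using qm_ideal[OF S(1) _ _ a] qm_SOS[OF S(1) h(2)] by blast
    then have "(\<lambda>z. h1 z + a z * s1 z) \<in> S" using qm_add[OF S(1) h(1)] by blast
    then have "(\<lambda>_. -1) \<in> S" by (rule qm_cong) (metis e1 mult.commute)
    then show False using S by auto
  qed
  with S show ?thesis using that by blast
qed

section \<open>Archimedean modules, characters and Putinar's theorem\<close>

definition archimedean :: "('z \<Rightarrow> real) set \<Rightarrow> bool" where
  "archimedean M \<longleftrightarrow> (\<forall>a\<in>A. \<exists>c. (\<lambda>z. c - a z) \<in> M)"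

text \<open>Unital homomorphisms of real algebras from \<open>A\<close> to the reals. They stand in
  for points: on polynomials each one is an evaluation, by \<open>character_polys\<close>.\<close>

definition character :: "(('z \<Rightarrow> real) \<Rightarrow> real) \<Rightarrow> bool" where
  "character \<phi> \<longleftrightarrow> (\<forall>c. \<phi> (\<lambda>_. c) = c) \<and> (\<forall>f\<in>A. \<forall>g\<in>A. \<phi> (\<lambda>z. f z + g z) = \<phi> f + \<phi> g) \<and>
     (\<forall>f\<in>A. \<forall>g\<in>A. \<phi> (\<lambda>z. f z * g z) = \<phi> f * \<phi> g)"

text \<open>A quadratic module is not closed under products, but
  \<open>(c - a) (c + a) = ((c - a)\<^sup>2 (c + a) + (c + a)\<^sup>2 (c - a)) / (2 c)\<close>.\<close>

lemma qm_square_bound: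
  assumes M: "quadratic_module M" and a: "a \<in> A" and c: "c > 0"
    and b: "(\<lambda>z. c - a z) \<in> M" "(\<lambda>z. c + a z) \<in> M"
  shows "(\<lambda>z. c\<^sup>2 - (a z)\<^sup>2) \<in> M"
proof (rule qm_cong)
  show "(\<lambda>z. 1 / (2 * c) * ((c - a z)\<^sup>2 * (c + a z) + (c + a z)\<^sup>2 * (c - a z))) \<in> M"
    using a c by (intro qm_scale[OF M] qm_add[OF M] qm_square_mult[OF M] b closed) auto
  show "1 / (2 * c) * ((c - a z)\<^sup>2 * (c + a z) + (c + a z)\<^sup>2 * (c - a z)) = c\<^sup>2 - (a z)\<^sup>2" for z
    using c by (simp add: field_simps power2_eq_square)
qed

text \<open>Totality makes \<open>D a\<close> a Dedekind cut, and the Archimedean property makes it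
  nonempty and bounded; \<open>\<phi> a\<close> is the real number it defines. Additivity comes from
  adding cuts. Since \<open>S\<close> need not be closed under products, multiplicativity is first
  proved for squares and then polarised.\<close>

lemma total_archimedean_character:
  assumes S: "quadratic_module S" and proper: "(\<lambda>_. -1) \<notin> S"
    and total: "\<And>a. a \<in> A \<Longrightarrow> a \<in> S \<or> (\<lambda>z. - a z) \<in> S"
    and arch: "archimedean S"
  obtains \<phi> where "character \<phi>" "\<And>a. a \<in> A \<Longrightarrow> a \<in> S \<Longrightarrow> \<phi> a \<ge> 0"
proof -
  define D where "D a = {r. (\<lambda>z. a z - r) \<in> S}" for a
  define \<phi> where "\<phi> a = Sup (D a)" for a
  have neg: "(\<lambda>_. c) \<notin> S" if "c < 0" for c
  proof
    assume "(\<lambda>_. c) \<in> S"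
    from qm_scale[OF S this, of "1 / -c"] that have "(\<lambda>_. -1) \<in> S" by simp
    with proper show False ..
  qed
  have lt: "r \<le> t" if "(\<lambda>z. a z - r) \<in> S" "(\<lambda>z. t - a z) \<in> S" for a r t
  proof (rule ccontr)
    assume "\<not> r \<le> t"
    moreover have "(\<lambda>_. t - r) \<in> S" using qm_cong[OF qm_add[OF S that]] by simp
    ultimately show False using neg[of "t - r"] by auto
  qed
  have bdd: "bdd_above (D a)" and ne: "D a \<noteq> {}" if a: "a \<in> A" for a
  proof -
    obtain t where "(\<lambda>z. t - a z) \<in> S" using arch a by (auto simp: archimedean_def)
    then show "bdd_above (D a)" using lt by (auto simp: bdd_above_def D_def)
    obtain u where "(\<lambda>z. u - (- a z)) \<in> S" using arch minus[OF a] by (auto simp: archimedean_def)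
    then have "- u \<in> D a" by (auto simp: D_def add.commute)
    then show "D a \<noteq> {}" by auto
  qed
  have lower: "(\<lambda>z. a z - r) \<in> S" if a: "a \<in> A" and r: "r < \<phi> a" for a r
  proof -
    obtain t where t: "t \<in> D a" "r < t" using r less_cSup_iff[OF ne[OF a] bdd[OF a]] by (auto simp: \<phi>_def)
    have "(\<lambda>z. (a z - t) + (t - r)) \<in> S"
      using t by (intro qm_add[OF S] qm_const[OF S]) (auto simp: D_def)
    then show ?thesis by simp
  qed
  have le: "r \<le> \<phi> a" if "a \<in> A" "(\<lambda>z. a z - r) \<in> S" for a r
    using that cSup_upper[of r "D a"] bdd by (auto simp: \<phi>_def D_def)
  \<comment> \<open>Totality enters here: if \<open>r - a\<close> were not in \<open>S\<close>, then
    \<open>a - r\<close> would be, forcing \<open>r \<le> \<phi> a\<close>.\<close>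
  have upper: "(\<lambda>z. r - a z) \<in> S" if a: "a \<in> A" and r: "r > \<phi> a" for a r
    using total[OF diff[OF a const[of r]]] le[OF a, of r] r by auto
  have ge: "\<phi> a \<le> r" if a: "a \<in> A" "(\<lambda>z. r - a z) \<in> S" for a r
    using lower[OF a(1)] lt[OF _ a(2)] by (meson dense_ge not_le order.strict_trans2 dense leD)
  have eqI: "\<phi> a = c" if a: "a \<in> A" and "\<And>e. e > 0 \<Longrightarrow> (\<lambda>z. a z - (c - e)) \<in> S"
    "\<And>e. e > 0 \<Longrightarrow> (\<lambda>z. (c + e) - a z) \<in> S" for a c
    by (rule antisym; rule field_le_epsilon)
       (use ge[OF a that(3)] le[OF a that(2)] in \<open>force simp: diff_le_eq\<close>)+
  have phi_const: "\<phi> (\<lambda>_. c) = c" for c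
    by (rule eqI) (auto intro: const qm_const[OF S])
  have phi_add: "\<phi> (\<lambda>z. f z + g z) = \<phi> f + \<phi> g" if f: "f \<in> A" and g: "g \<in> A" for f g
  proof (rule eqI[OF add[OF f g]])
    fix e :: real assume e: "e > 0"
    show "(\<lambda>z. f z + g z - (\<phi> f + \<phi> g - e)) \<in> S"
      by (rule qm_cong[OF qm_add[OF S lower[OF f, of "\<phi> f - e/2"] lower[OF g, of "\<phi> g - e/2"]]])
         (use e in auto)
    show "(\<lambda>z. \<phi> f + \<phi> g + e - (f z + g z)) \<in> S"
      by (rule qm_cong[OF qm_add[OF S upper[OF f, of "\<phi> f + e/2"] upper[OF g, of "\<phi> g + e/2"]]])
         (use e in auto)
  qed
  \<comment> \<open>When \<open>\<phi> f = 0\<close>, both \<open>sqrt e - f\<close> and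
    \<open>sqrt e + f\<close> lie in \<open>S\<close> for every \<open>e > 0\<close>, so
    \<open>qm_square_bound\<close> gives \<open>e - f^2\<close> in \<open>S\<close>.\<close>
  have phi_sq0: "\<phi> (\<lambda>z. (f z)\<^sup>2) = 0" if f: "f \<in> A" and 0: "\<phi> f = 0" for f
  proof (rule eqI[OF power[OF f]])
    fix e :: real assume e: "e > 0"
    show "(\<lambda>z. (f z)\<^sup>2 - (0 - e)) \<in> S"
      using qm_add[OF S qm_square[OF S f] qm_const[OF S, of e]] e by simp
    have "(\<lambda>z. (sqrt e)\<^sup>2 - (f z)\<^sup>2) \<in> S"
      using e upper[OF f, of "sqrt e"] lower[OF f, of "- sqrt e"] 0
      by (intro qm_square_bound[OF S f]) (auto simp: add.commute)
    then show "(\<lambda>z. 0 + e - (f z)\<^sup>2) \<in> S" using e by simp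
  qed
  have phi_scale: "\<phi> (\<lambda>z. c * f z) = c * \<phi> f" if f: "f \<in> A" for f c
  proof -
    have pos: "\<phi> (\<lambda>z. c * f z) = c * \<phi> f" if c: "c > 0" for c
    proof (rule eqI[OF scale[OF f]])
      fix e :: real assume e: "e > 0"
      show "(\<lambda>z. c * f z - (c * \<phi> f - e)) \<in> S"
        by (rule qm_cong[OF qm_scale[OF S lower[OF f, of "\<phi> f - e/c"], of c]])
           (use e c in \<open>auto simp: field_simps\<close>)
      show "(\<lambda>z. c * \<phi> f + e - c * f z) \<in> S"
        by (rule qm_cong[OF qm_scale[OF S upper[OF f, of "\<phi> f + e/c"], of c]])
           (use e c in \<open>auto simp: field_simps\<close>)
    qed
    have neg: "\<phi> (\<lambda>z. c * f z) = c * \<phi> f" if "c < 0" for c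
      using phi_add[OF scale[OF f, of c] scale[OF f, of "-c"]] pos[of "-c"] phi_const[of 0] that by simp
    show ?thesis using pos neg phi_const[of 0] by (cases "c > 0"; cases "c = 0") auto
  qed
  have phi_sq: "\<phi> (\<lambda>z. (f z)\<^sup>2) = (\<phi> f)\<^sup>2" if f: "f \<in> A" for f
  proof -
    \<comment> \<open>Shifting by the constant \<open>\<phi> f\<close> reduces the general square to
      the case \<open>\<phi> f = 0\<close>.\<close>
    have fm: "(\<lambda>z. f z + (- \<phi> f)) \<in> A" by (intro closed f)
    have "\<phi> (\<lambda>z. f z + (- \<phi> f)) = 0" using phi_add[OF f const[of "- \<phi> f"]] phi_const[of "- \<phi> f"] by linarith
    from phi_sq0[OF fm this]
    have "0 = \<phi> (\<lambda>z. (f z)\<^sup>2 + ((- 2 * \<phi> f) * f z + (\<phi> f)\<^sup>2))"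
      by (simp add: power2_eq_square algebra_simps)
    also have "\<dots> = \<phi> (\<lambda>z. (f z)\<^sup>2) - 2 * \<phi> f * \<phi> f + (\<phi> f)\<^sup>2"
      by (subst phi_add; (subst phi_add)?) (auto intro!: closed f simp: phi_const phi_scale[OF f, of "-2 * \<phi> f", simplified])
    finally show ?thesis by (simp add: power2_eq_square)
  qed
  have phi_mult: "\<phi> (\<lambda>z. f z * g z) = \<phi> f * \<phi> g" if f: "f \<in> A" and g: "g \<in> A" for f g
  proof -
    have "(\<phi> f + \<phi> g)\<^sup>2 = \<phi> (\<lambda>z. (f z + g z)\<^sup>2)" using phi_sq[OF add[OF f g]] phi_add[OF f g] by simp
    also have "\<dots> = \<phi> (\<lambda>z. (f z)\<^sup>2 + ((g z)\<^sup>2 + 2 * (f z * g z)))"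
      by (simp add: power2_eq_square algebra_simps)
    also have "\<dots> = (\<phi> f)\<^sup>2 + ((\<phi> g)\<^sup>2 + 2 * \<phi> (\<lambda>z. f z * g z))"
      by (subst phi_add; (subst phi_add)?)
         (auto intro!: closed f g simp: phi_sq f g phi_scale[OF mult[OF f g]])
    finally show ?thesis by (simp add: power2_eq_square algebra_simps)
  qed
  show ?thesis
  proof
    show "character \<phi>" by (auto simp: character_def phi_const phi_add phi_mult)
    show "\<phi> a \<ge> 0" if "a \<in> A" "a \<in> S" for a using le[OF that(1), of 0] that by simp
  qed
qed

theorem putinar_abstract:
  assumes M: "quadratic_module M" and arch: "archimedean M" and f: "f \<in> A"
    and pos: "\<And>\<phi>. character \<phi> \<Longrightarrow> (\<And>a. a \<in> A \<Longrightarrow> a \<in> M \<Longrightarrow> \<phi> a \<ge> 0) \<Longrightarrow> \<phi> f > 0"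
  shows "f \<in> M"
proof -
  let ?N = "adjoin M (\<lambda>z. - f z)"
  \<comment> \<open>Otherwise a character of a maximal proper module above \<open>?N\<close> would
    be nonnegative on \<open>M\<close> and on \<open>- f\<close>, against the hypothesis
    \<open>\<phi> f > 0\<close>.\<close>
  have "(\<lambda>_. -1) \<in> ?N"
  proof (rule ccontr)
    assume "(\<lambda>_. -1) \<notin> ?N"
    then obtain S where S: "quadratic_module S" "?N \<subseteq> S" "(\<lambda>_. -1) \<notin> S"
      "\<And>a. a \<in> A \<Longrightarrow> a \<in> S \<or> (\<lambda>z. - a z) \<in> S"
      using maximal_proper_qm[OF adjoin_qm[OF M]] by blast
    have MS: "M \<subseteq> S" using adjoin_superset[of M] S(2) by blast
    have "archimedean S" using arch MS by (auto simp: archimedean_def)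
    then obtain \<phi> where phi: "character \<phi>" "\<And>a. a \<in> A \<Longrightarrow> a \<in> S \<Longrightarrow> \<phi> a \<ge> 0"
      using total_archimedean_character[OF S(1,3,4)] by blast
    have "\<phi> f > 0" using pos[OF phi(1)] phi(2) MS by blast
    moreover have "\<phi> (\<lambda>z. - f z) \<ge> 0" using phi(2)[OF minus[OF f]] adjoin_mem[OF M] S(2) by blast
    moreover have "\<phi> (\<lambda>z. f z + (- f z)) = \<phi> f + \<phi> (\<lambda>z. - f z)" and "\<phi> (\<lambda>_. 0) = 0"
      using phi(1) f minus[OF f] by (auto simp only: character_def)
    ultimately show False by simp
  qed
  then obtain h s where h: "h \<in> M" and s: "s \<in> SOS" and "(\<lambda>_. -1) = (\<lambda>z. h z + s z * (- f z))"
    by (auto simp: adjoin_def)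
  then have "-1 = h z + s z * (- f z)" for z by meson
  then have e: "s z * f z - 1 = h z" for z by (smt (verit) mult_minus_right)
  then have sf: "(\<lambda>z. s z * f z - 1) \<in> M" using h by simp
  have sA: "s \<in> A" using s by (rule SOS_in_A)
  obtain c1 where c1: "(\<lambda>z. c1 - s z) \<in> M" using arch sA by (auto simp: archimedean_def)
  obtain c2 where c2: "(\<lambda>z. c2 - (s z)\<^sup>2 * f z) \<in> M"
    using arch mult[OF power[OF sA, of 2] f] by (auto simp: archimedean_def)
  obtain c3 where c3: "(\<lambda>z. c3 - (- f z)) \<in> M" using arch minus[OF f] by (auto simp: archimedean_def)
  \<comment> \<open>\<open>N\<close> is large enough that \<open>2 * N - s\<close> lies in
    \<open>M\<close> (via \<open>c1\<close>) and that the constant \<open>2 * N - c2 - 1\<close> is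
    nonnegative.\<close>
  define N where "N = max 1 (max c1 (c2 + 1))"
  have N: "N > 0" "2 * N \<ge> c1" "2 * N \<ge> c2 + 1"
  proof -
    have "N \<ge> 1" "N \<ge> c1" "N \<ge> c2 + 1" by (auto simp: N_def)
    then show "N > 0" "2 * N \<ge> c1" "2 * N \<ge> c2 + 1" by linarith+
  qed
  \<comment> \<open>In the expansion of \<open>N^2 * (f + r)\<close>, the part
    \<open>s * (2 * N - s) * f\<close> exceeds 1 by
    \<open>2 * N * (s * f - 1) + (c2 - s^2 * f) + (2 * N - c2 - 1)\<close>, which is in
    \<open>M\<close>. This surplus 1 is what allows \<open>r\<close> to drop by
    \<open>1 / N^2\<close>. The condition \<open>r \<ge> 0\<close> keeps the remaining term
    \<open>r * s * (2 * N - s)\<close> in \<open>M\<close>.\<close>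
  have step: "(\<lambda>z. f z + (r - 1 / N\<^sup>2)) \<in> M" if r: "r \<ge> 0" and fr: "(\<lambda>z. f z + r) \<in> M" for r
  proof (rule qm_cong)
    show "(\<lambda>z. 1 / N\<^sup>2 * ((N - s z)\<^sup>2 * (f z + r) + (2 * N * (s z * f z - 1) +
       ((c2 - (s z)\<^sup>2 * f z) + ((2 * N - c2 - 1) + r * (s z * ((c1 - s z) + (2 * N - c1)))))))) \<in> M"
      using N r by (intro qm_scale[OF M] qm_add[OF M] qm_square_mult[OF M] qm_SOS_mult[OF M] fr sf c1 c2
          closed sA s qm_const[OF M]) auto
    fix z
    have *: "(N - s z)\<^sup>2 * (f z + r) + (2 * N * (s z * f z - 1) +
       ((c2 - (s z)\<^sup>2 * f z) + ((2 * N - c2 - 1) + r * (s z * ((c1 - s z) + (2 * N - c1)))))) =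
       N\<^sup>2 * (f z + r) - 1" by (simp add: power2_eq_square algebra_simps)
    show "1 / N\<^sup>2 * ((N - s z)\<^sup>2 * (f z + r) + (2 * N * (s z * f z - 1) +
       ((c2 - (s z)\<^sup>2 * f z) + ((2 * N - c2 - 1) + r * (s z * ((c1 - s z) + (2 * N - c1))))))) =
       f z + (r - 1 / N\<^sup>2)" unfolding * using N by (simp add: field_simps)
  qed
  have weaken: "(\<lambda>z. f z + t) \<in> M" if "(\<lambda>z. f z + r) \<in> M" "r \<le> t" for r t
    by (rule qm_cong[OF qm_add[OF M that(1) qm_const[OF M, of "t - r"]]]) (use that(2) in auto)
  \<comment> \<open>The descent starts at \<open>f + c3\<close>. The \<open>max 0\<close> preserves
    the condition \<open>r \<ge> 0\<close> of \<open>step\<close>, and the remainder reaches 0 once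
    \<open>k > \<bar>c3\<bar> * N^2\<close>.\<close>
  have iter: "(\<lambda>z. f z + max 0 (\<bar>c3\<bar> - real k / N\<^sup>2)) \<in> M" for k
  proof (induction k)
    case 0
    then show ?case using weaken[of c3 "\<bar>c3\<bar>"] c3 by (simp add: add.commute)
  next
    case (Suc k)
    have "(\<lambda>z. f z + (max 0 (\<bar>c3\<bar> - real k / N\<^sup>2) - 1 / N\<^sup>2)) \<in> M" by (rule step[OF _ Suc]) simp
    then show ?case
    proof (rule weaken)
      have "0 \<le> 1 / N\<^sup>2" by simp
      then show "max 0 (\<bar>c3\<bar> - real k / N\<^sup>2) - 1 / N\<^sup>2 \<le> max 0 (\<bar>c3\<bar> - real (Suc k) / N\<^sup>2)"
        unfolding of_nat_Suc add_divide_distrib by linarith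
    qed
  qed
  obtain k :: nat where "real k > \<bar>c3\<bar> * N\<^sup>2" using reals_Archimedean2 by blast
  then have "max 0 (\<bar>c3\<bar> - real k / N\<^sup>2) = 0" using N by (auto simp: field_simps max_def)
  then show ?thesis using iter[of k] by simp
qed

section \<open>Bounded elements form a subalgebra, so the Archimedean property can be checked on
  generators\<close>

definition bounded_elt :: "('z \<Rightarrow> real) set \<Rightarrow> ('z \<Rightarrow> real) \<Rightarrow> bool" where
  "bounded_elt M a \<longleftrightarrow> a \<in> A \<and> (\<exists>c>0. (\<lambda>z. c - a z) \<in> M \<and> (\<lambda>z. c + a z) \<in> M)"

lemma bounded_eltI:
  assumes M: "quadratic_module M" and "a \<in> A" "(\<lambda>z. c - a z) \<in> M" "(\<lambda>z. c' + a z) \<in> M"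
  shows "bounded_elt M a"
proof -
  let ?c = "max 1 (max c c')"
  have "(\<lambda>z. ?c - a z) \<in> M"
    by (rule qm_cong[OF qm_add[OF M assms(3) qm_const[OF M, of "?c - c"]]]) auto
  moreover have "(\<lambda>z. ?c + a z) \<in> M"
    by (rule qm_cong[OF qm_add[OF M assms(4) qm_const[OF M, of "?c - c'"]]]) auto
  ultimately show ?thesis unfolding bounded_elt_def using assms(2)
    by (intro conjI exI[of _ ?c]) auto
qed

lemma bounded_elt_const: "quadratic_module M \<Longrightarrow> bounded_elt M (\<lambda>_. c)"
  by (rule bounded_eltI[of _ _ c "- c"]) (auto intro: const qm_const)

lemma bounded_elt_add:
  assumes M: "quadratic_module M" and "bounded_elt M a" "bounded_elt M b"
  shows "bounded_elt M (\<lambda>z. a z + b z)"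
proof -
  obtain c d where *: "(\<lambda>z. c - a z) \<in> M" "(\<lambda>z. c + a z) \<in> M" "(\<lambda>z. d - b z) \<in> M" "(\<lambda>z. d + b z) \<in> M"
    using assms by (auto simp: bounded_elt_def)
  show ?thesis
    using qm_add[OF M *(1,3)] qm_add[OF M *(2,4)] assms
    by (intro bounded_eltI[of _ _ "c + d" "c + d"])
       (auto simp: bounded_elt_def M algebra_simps intro: add)
qed

lemma bounded_elt_scale:
  assumes M: "quadratic_module M" and "bounded_elt M a"
  shows "bounded_elt M (\<lambda>z. r * a z)"
proof -
  obtain c where *: "(\<lambda>z. c - a z) \<in> M" "(\<lambda>z. c + a z) \<in> M" "a \<in> A"
    using assms by (auto simp: bounded_elt_def)
  show ?thesis
  proof (cases "r \<ge> 0")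
    case True
    then show ?thesis
      using qm_scale[OF M *(1), of r] qm_scale[OF M *(2), of r] *(3)
      by (intro bounded_eltI[of _ _ "r * c" "r * c"]) (auto simp: M algebra_simps intro: scale)
  next
    case False
    then show ?thesis
      using qm_scale[OF M *(1), of "-r"] qm_scale[OF M *(2), of "-r"] *(3)
      by (intro bounded_eltI[of _ _ "- r * c" "- r * c"]) (auto simp: M algebra_simps intro: scale)
  qed
qed

lemma bounded_elt_square:
  assumes M: "quadratic_module M" and "bounded_elt M a"
  shows "bounded_elt M (\<lambda>z. (a z)\<^sup>2)"
proof -
  obtain c where *: "c > 0" "(\<lambda>z. c - a z) \<in> M" "(\<lambda>z. c + a z) \<in> M" "a \<in> A"
    using assms by (auto simp: bounded_elt_def)
  show ?thesis
    using qm_square_bound[OF M *(4,1-3)] qm_square[OF M *(4)]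
    by (intro bounded_eltI[of _ _ "c\<^sup>2" 0]) (auto simp: M *(4) intro: power)
qed

text \<open>Polarisation reduces products to squares:
  \<open>a * b = ((a + b)^2 - (a - b)^2) / 4\<close>.\<close>

lemma bounded_elt_mult:
  assumes M: "quadratic_module M" and a: "bounded_elt M a" and b: "bounded_elt M b"
  shows "bounded_elt M (\<lambda>z. a z * b z)"
proof -
  have "bounded_elt M (\<lambda>z. 1/4 * (a z + b z)\<^sup>2 + (-1/4) * (a z + (-1) * b z)\<^sup>2)"
    by (intro bounded_elt_add bounded_elt_scale bounded_elt_square assms)
  then show ?thesis by (rule back_subst) (auto simp: fun_eq_iff power2_eq_square algebra_simps)
qed

text \<open>Adding the square \<open>(1 + a)^2\<close> or \<open>(1 - a)^2\<close> to
  \<open>c - a^2\<close> removes the quadratic term and leaves \<open>c + 1 + 2 * a\<close> or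
  \<open>c + 1 - 2 * a\<close>.\<close>

lemma bounded_eltI_square:
  assumes M: "quadratic_module M" and a: "a \<in> A" and c: "(\<lambda>z. c - (a z)\<^sup>2) \<in> M"
  shows "bounded_elt M a"
proof -
  have "(\<lambda>z. 1/2 * ((c - (a z)\<^sup>2) + (1 + a z)\<^sup>2)) \<in> M" "(\<lambda>z. 1/2 * ((c - (a z)\<^sup>2) + (1 - a z)\<^sup>2)) \<in> M"
    by (intro qm_scale[OF M] qm_add[OF M] c qm_square[OF M] closed a; simp)+
  then have "(\<lambda>z. (c + 1) / 2 + a z) \<in> M" "(\<lambda>z. (c + 1) / 2 - a z) \<in> M"
    by (auto simp: field_simps power2_eq_square)
  then show ?thesis using a by (intro bounded_eltI[OF M])
qed

end

section \<open>Root bounds in a quadratic module\<close>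

context function_algebra
begin

lemma SOS_scale: "s \<in> SOS \<Longrightarrow> c \<ge> 0 \<Longrightarrow> (\<lambda>z. c * s z) \<in> SOS"
  using SOS_square_mult[OF _ const[of "sqrt c"], of s] by simp

lemma qm_SOS_power: "quadratic_module M \<Longrightarrow> s \<in> SOS \<Longrightarrow> (\<lambda>z. s z ^ k) \<in> M"
  by (induction k) (simp_all add: qm_one qm_SOS_mult)

text \<open>Here \<open>1 + u\<^sup>m - u\<^sup>k = (1 - u\<^sup>k) (1 - u\<^bsup>m-k\<^esup>) + u\<^bsup>m-k\<^esup>\<close>, whose first summand
  is \<open>(1 - u)\<^sup>2\<close> times a polynomial in \<open>u\<close> with nonnegative coefficients.\<close>

lemma qm_power_le:
  assumes M: "quadratic_module M" and u: "u \<in> SOS" and "k \<le> m"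
  shows "(\<lambda>z. 1 + u z ^ m - u z ^ k) \<in> M"
proof (rule qm_cong)
  show "(\<lambda>z. (1 - u z)\<^sup>2 * (\<Sum>i<k. \<Sum>j<m-k. u z ^ (i + j)) + u z ^ (m - k)) \<in> M"
    using u by (intro qm_add[OF M] qm_square_mult[OF M] qm_sum[OF M] qm_SOS_power[OF M] closed SOS_in_A)
  fix z
  have "(1 - u z)\<^sup>2 * (\<Sum>i<k. \<Sum>j<m-k. u z ^ (i + j)) =
      ((1 - u z) * (\<Sum>i<k. u z ^ i)) * ((1 - u z) * (\<Sum>j<m-k. u z ^ j))"
    by (simp add: power_add power2_eq_square sum_product algebra_simps)
  also have "\<dots> = (1 - u z ^ k) * (1 - u z ^ (m - k))" by (simp only: one_diff_power_eq)
  also have "\<dots> = 1 - u z ^ k - u z ^ (m - k) + u z ^ m"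
    using \<open>k \<le> m\<close> by (simp add: algebra_simps flip: power_add)
  finally show "(1 - u z)\<^sup>2 * (\<Sum>i<k. \<Sum>j<m-k. u z ^ (i + j)) + u z ^ (m - k) = 1 + u z ^ m - u z ^ k"
    by simp
qed

text \<open>This certifies that \<open>t^m \<le> C * (1 + t + ... + t^(m-1))\<close> bounds
  \<open>t\<close>. After rescaling \<open>t = D * u\<close>, the terms on the right are at most
  \<open>E * (1 + u^m)\<close> with \<open>E \<le> D^m / 2\<close>. Absorbing \<open>E * u^m\<close>
  on the left bounds \<open>u^m\<close>, and \<open>u \<le> 1 + u^m\<close> then bounds
  \<open>u\<close>.\<close>

lemma qm_root_bound:
  assumes M: "quadratic_module M" and t: "t \<in> SOS" and m: "m \<ge> 1" and C: "C \<ge> 0"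
    and b: "(\<lambda>z. C * (\<Sum>k<m. t z ^ k) - t z ^ m) \<in> M"
  shows "\<exists>c. (\<lambda>z. c - t z) \<in> M"
proof -
  \<comment> \<open>This choice gives both \<open>D \<ge> 1\<close> and
    \<open>m * C \<le> D / 2\<close>, the two facts behind \<open>E \<le> D^m / 2\<close>.\<close>
  define D where "D = 2 * real m * C + 1"
  have D: "D \<ge> 1" using C by (simp add: D_def)
  define u where "u z = 1 / D * t z" for z
  have u: "u \<in> SOS" unfolding u_def[abs_def] using D by (intro SOS_scale t) auto
  have tu: "t z = D * u z" for z using D by (simp add: u_def)
  define E where "E = (\<Sum>k<m. C * D ^ k)"
  have "E \<le> (\<Sum>k<m. C * D ^ (m - 1))"
    unfolding E_def using C D by (intro sum_mono mult_left_mono power_increasing) auto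
  also have "\<dots> = real m * C * D ^ (m - 1)" by simp
  also have "\<dots> \<le> D / 2 * D ^ (m - 1)" using D by (intro mult_right_mono) (auto simp: D_def)
  also have "\<dots> = D ^ m / 2" using m by (simp add: power_eq_if)
  finally have E: "E \<le> D ^ m / 2" .
  \<comment> \<open>The inner bracket collapses to \<open>E - D^m / 2 * u^m\<close>; scaled by
    \<open>2 / D^m\<close> and added to \<open>1 + u^m - u\<close>, it leaves a constant minus
    \<open>u\<close>.\<close>
  have "(\<lambda>z. 2 / D ^ m * ((C * (\<Sum>k<m. t z ^ k) - t z ^ m) + ((\<Sum>k<m. C * D ^ k * (1 + u z ^ m - u z ^ k))
      + (D ^ m / 2 - E) * u z ^ m)) + (1 + u z ^ m - u z ^ 1)) \<in> M"
    using E D C m by (intro qm_add[OF M] qm_scale[OF M] qm_sum[OF M] b qm_power_le[OF M u] qm_SOS_power[OF M u]) auto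
  then have "(\<lambda>z. D * (2 / D ^ m * ((C * (\<Sum>k<m. t z ^ k) - t z ^ m) + ((\<Sum>k<m. C * D ^ k * (1 + u z ^ m - u z ^ k))
      + (D ^ m / 2 - E) * u z ^ m)) + (1 + u z ^ m - u z ^ 1))) \<in> M"
    using D by (intro qm_scale[OF M]) auto
  then have "(\<lambda>z. D * (2 * E / D ^ m + 1) - t z) \<in> M"
  proof (rule qm_cong)
    fix z
    have "(\<Sum>k<m. C * D ^ k * (1 + u z ^ m - u z ^ k)) = E * (1 + u z ^ m) - C * (\<Sum>k<m. t z ^ k)"
      by (simp add: E_def tu power_mult_distrib sum_distrib_left sum_distrib_right
        sum_subtractf algebra_simps sum.distrib)
    then have "(C * (\<Sum>k<m. t z ^ k) - t z ^ m) + ((\<Sum>k<m. C * D ^ k * (1 + u z ^ m - u z ^ k))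
      + (D ^ m / 2 - E) * u z ^ m) = E - D ^ m / 2 * u z ^ m"
      by (simp add: tu power_mult_distrib algebra_simps)
    then show "D * (2 / D ^ m * ((C * (\<Sum>k<m. t z ^ k) - t z ^ m) + ((\<Sum>k<m. C * D ^ k * (1 + u z ^ m - u z ^ k))
      + (D ^ m / 2 - E) * u z ^ m)) + (1 + u z ^ m - u z ^ 1)) = D * (2 * E / D ^ m + 1) - t z"
      using D by (simp add: tu field_simps)
  qed
  then show ?thesis by blast
qed

section \<open>Complex-valued functions with real and imaginary parts in the algebra\<close>

definition complex_closure :: "('z \<Rightarrow> complex) set" where
  "complex_closure = {F. (\<lambda>z. Re (F z)) \<in> A \<and> (\<lambda>z. Im (F z)) \<in> A}"

lemma complex_closure_of_real: "f \<in> A \<Longrightarrow> (\<lambda>z. complex_of_real (f z)) \<in> complex_closure"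
  by (auto simp: complex_closure_def intro: closed)

lemma complex_closure_add:
  "F \<in> complex_closure \<Longrightarrow> G \<in> complex_closure \<Longrightarrow> (\<lambda>z. F z + G z) \<in> complex_closure"
  by (auto simp: complex_closure_def intro: closed)

lemma complex_closure_mult:
  "F \<in> complex_closure \<Longrightarrow> G \<in> complex_closure \<Longrightarrow> (\<lambda>z. F z * G z) \<in> complex_closure"
  by (auto simp: complex_closure_def intro!: closed)

lemma complex_closure_sum:
  "(\<And>i. i \<in> I \<Longrightarrow> F i \<in> complex_closure) \<Longrightarrow> (\<lambda>z. \<Sum>i\<in>I. F i z) \<in> complex_closure"
  using complex_closure_of_real[OF const[of 0]]
  by (induction I rule: infinite_finite_induct) (simp_all add: complex_closure_add)

lemma complex_closure_prod:
  "(\<And>i. i \<in> I \<Longrightarrow> F i \<in> complex_closure) \<Longrightarrow> (\<lambda>z. \<Prod>i\<in>I. F i z) \<in> complex_closure"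
  using complex_closure_of_real[OF const[of 1]]
  by (induction I rule: infinite_finite_induct) (simp_all add: complex_closure_mult)

lemma complex_closure_power: "F \<in> complex_closure \<Longrightarrow> (\<lambda>z. F z ^ k) \<in> complex_closure"
  using complex_closure_of_real[OF const[of 1]]
  by (induction k) (simp_all add: complex_closure_mult)

lemmas complex_closure_intros = complex_closure_of_real complex_closure_add complex_closure_mult
  complex_closure_sum complex_closure_prod complex_closure_power

lemma SOS_cmod_square: "F \<in> complex_closure \<Longrightarrow> (\<lambda>z. (cmod (F z))\<^sup>2) \<in> SOS"
  unfolding cmod_power2 by (auto simp: complex_closure_def intro: SOS.intros)

text \<open>Lagrange's identity gives the Cauchy--Schwarz inequality with a sum of squares as the gap.\<close>

lemma qm_cauchy_schwarz:
  fixes v :: "nat \<Rightarrow> 'z \<Rightarrow> complex"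
  assumes M: "quadratic_module M" and v: "\<And>k. k < m \<Longrightarrow> v k \<in> complex_closure"
  shows "(\<lambda>z. real m * (\<Sum>k<m. (cmod (v k z))\<^sup>2) - (cmod (\<Sum>k<m. v k z))\<^sup>2) \<in> M"
proof (rule qm_cong)
  show "(\<lambda>z. 1/2 * (\<Sum>j<m. \<Sum>k<m. (cmod (v j z + of_real (-1) * v k z))\<^sup>2)) \<in> M"
    by (intro qm_scale[OF M] qm_sum[OF M] qm_SOS[OF M] SOS_cmod_square complex_closure_intros v const) auto
  fix z
  have lag: "(\<Sum>j<m. \<Sum>k<m. (f j - f k)\<^sup>2) = 2 * (real m * (\<Sum>k<m. (f k)\<^sup>2) - (\<Sum>k<m. f k)\<^sup>2)" for f :: "nat \<Rightarrow> real"
  proof -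
    have "(\<Sum>j<m. \<Sum>k<m. (f j - f k)\<^sup>2) =
        (\<Sum>j<m. \<Sum>k<m. (f j)\<^sup>2) + (\<Sum>j<m. \<Sum>k<m. (f k)\<^sup>2) - (\<Sum>j<m. \<Sum>k<m. 2 * f j * f k)"
      by (simp add: power2_diff sum.distrib sum_subtractf)
    also have "(\<Sum>j<m. \<Sum>k<m. 2 * f j * f k) = 2 * (\<Sum>k<m. f k)\<^sup>2"
      by (simp add: power2_eq_square sum_product sum_distrib_left mult_ac)
    finally show ?thesis by (simp add: sum_distrib_left algebra_simps)
  qed
  have "(\<Sum>j<m. \<Sum>k<m. (cmod (v j z + of_real (-1) * v k z))\<^sup>2) =
     (\<Sum>j<m. \<Sum>k<m. (Re (v j z) - Re (v k z))\<^sup>2) + (\<Sum>j<m. \<Sum>k<m. (Im (v j z) - Im (v k z))\<^sup>2)"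
    by (simp add: cmod_power2 sum.distrib)
  also have "\<dots> = 2 * (real m * (\<Sum>k<m. (cmod (v k z))\<^sup>2) - (cmod (\<Sum>k<m. v k z))\<^sup>2)"
    unfolding lag cmod_power2 sum.distrib Re_sum Im_sum by (simp add: algebra_simps)
  finally show "1/2 * (\<Sum>j<m. \<Sum>k<m. (cmod (v j z + of_real (-1) * v k z))\<^sup>2) =
     real m * (\<Sum>k<m. (cmod (v k z))\<^sup>2) - (cmod (\<Sum>k<m. v k z))\<^sup>2" by simp
qed

end

section \<open>Polynomial functions\<close>

text \<open>A sum over an infinite set is 0 by convention, so the sums in \<open>poly_fun\<close>
  depend on this. Exponents from \<open>N\<close> on are fixed at 0 and the others are at most
  \<open>nat k\<close>.\<close>

lemma finite_mono_set: "finite (mono_set N k)"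
proof -
  have "mono_set N k \<subseteq> (\<lambda>f i. if i < N then f i else 0) ` (PiE {..<N} (\<lambda>_. {..nat k}))"
  proof
    fix \<alpha> assume a: "\<alpha> \<in> mono_set N k"
    have "\<alpha> i \<le> nat k" if "i < N" for i
      using member_le_sum[of i "{..<N}" \<alpha>] that a by (auto simp: mono_set_def simp del: of_nat_sum)
    then have "restrict \<alpha> {..<N} \<in> PiE {..<N} (\<lambda>_. {..nat k})" by auto
    moreover have "\<alpha> = (\<lambda>i. if i < N then restrict \<alpha> {..<N} i else 0)" using a by (auto simp: mono_set_def)
    ultimately show "\<alpha> \<in> (\<lambda>f i. if i < N then f i else 0) ` (PiE {..<N} (\<lambda>_. {..nat k}))" by blast
  qed
  then show ?thesis by (rule finite_subset) (auto intro!: finite_imageI finite_PiE)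
qed

lemma poly_fun_add: "poly_fun N k f \<Longrightarrow> poly_fun N k g \<Longrightarrow> poly_fun N k (\<lambda>z. f z + g z)"
  unfolding poly_fun_def
proof (elim exE)
  fix c d assume "\<forall>z. f z = (\<Sum>\<alpha>\<in>mono_set N k. c \<alpha> * (\<Prod>i<N. z i ^ \<alpha> i))"
    "\<forall>z. g z = (\<Sum>\<alpha>\<in>mono_set N k. d \<alpha> * (\<Prod>i<N. z i ^ \<alpha> i))"
  then show "\<exists>c. \<forall>z. f z + g z = (\<Sum>\<alpha>\<in>mono_set N k. c \<alpha> * (\<Prod>i<N. z i ^ \<alpha> i))"
    by (intro exI[of _ "\<lambda>\<alpha>. c \<alpha> + d \<alpha>"]) (simp add: distrib_right sum.distrib)
qed

lemma poly_fun_scale: "poly_fun N k f \<Longrightarrow> poly_fun N k (\<lambda>z. r * f z)"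
  unfolding poly_fun_def
proof (elim exE)
  fix c assume "\<forall>z. f z = (\<Sum>\<alpha>\<in>mono_set N k. c \<alpha> * (\<Prod>i<N. z i ^ \<alpha> i))"
  then show "\<exists>c. \<forall>z. r * f z = (\<Sum>\<alpha>\<in>mono_set N k. c \<alpha> * (\<Prod>i<N. z i ^ \<alpha> i))"
    by (intro exI[of _ "\<lambda>\<alpha>. r * c \<alpha>"]) (simp add: sum_distrib_left mult.assoc)
qed

lemma poly_fun_zero: "poly_fun N k (\<lambda>_. 0)"
  unfolding poly_fun_def by (intro exI[of _ "\<lambda>_. 0"]) simp

lemma poly_fun_sum: "(\<And>i. i \<in> I \<Longrightarrow> poly_fun N k (f i)) \<Longrightarrow> poly_fun N k (\<lambda>z. \<Sum>i\<in>I. f i z)"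
  by (induction I rule: infinite_finite_induct) (simp_all add: poly_fun_zero poly_fun_add)

lemma poly_fun_monomial:
  assumes "\<alpha> \<in> mono_set N k"
  shows "poly_fun N k (\<lambda>z. \<Prod>i<N. z i ^ \<alpha> i)"
  unfolding poly_fun_def
proof (intro exI allI)
  fix z :: "nat \<Rightarrow> real"
  have "(\<Sum>\<beta>\<in>mono_set N k. (if \<beta> = \<alpha> then 1 else 0) * (\<Prod>i<N. z i ^ \<beta> i)) =
    (\<Sum>\<beta>\<in>{\<alpha>}. (if \<beta> = \<alpha> then 1 else 0) * (\<Prod>i<N. z i ^ \<beta> i))"
    using assms by (intro sum.mono_neutral_right finite_mono_set) auto
  then show "(\<Prod>i<N. z i ^ \<alpha> i) = (\<Sum>\<beta>\<in>mono_set N k. (if \<beta> = \<alpha> then 1 else 0) * (\<Prod>i<N. z i ^ \<beta> i))"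
    by simp
qed

lemma poly_fun_expand:
  assumes "poly_fun N k f"
  obtains c where "f = (\<lambda>z. \<Sum>\<alpha>\<in>mono_set N k. c \<alpha> * (\<Prod>i<N. z i ^ \<alpha> i))"
  using assms by (auto simp: poly_fun_def fun_eq_iff)

lemma poly_fun_weaken:
  assumes f: "poly_fun N k f" and "N \<le> N'" "k \<le> k'"
  shows "poly_fun N' k' f"
proof -
  obtain c where f: "f = (\<lambda>z. \<Sum>\<alpha>\<in>mono_set N k. c \<alpha> * (\<Prod>i<N. z i ^ \<alpha> i))"
    using f by (rule poly_fun_expand)
  have "poly_fun N' k' (\<lambda>z. \<Prod>i<N. z i ^ \<alpha> i)" if a: "\<alpha> \<in> mono_set N k" for \<alpha>
  proof -
    have "sum \<alpha> {..<N'} = sum \<alpha> {..<N}"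
      using a assms(2) by (intro sum.mono_neutral_right) (auto simp: mono_set_def)
    then have "\<alpha> \<in> mono_set N' k'" using a assms by (auto simp: mono_set_def simp del: of_nat_sum)
    moreover have "(\<Prod>i<N'. z i ^ \<alpha> i) = (\<Prod>i<N. z i ^ \<alpha> i)" for z :: "nat \<Rightarrow> real"
      using a assms(2) by (intro prod.mono_neutral_right) (auto simp: mono_set_def)
    ultimately show ?thesis using poly_fun_monomial[of \<alpha> N' k'] by simp
  qed
  then show ?thesis unfolding f by (intro poly_fun_sum poly_fun_scale)
qed

lemma poly_fun_mult:
  assumes f: "poly_fun N k f" and g: "poly_fun N l g"
  shows "poly_fun N (k + l) (\<lambda>z. f z * g z)"
proof -
  obtain c where c: "f = (\<lambda>z. \<Sum>\<alpha>\<in>mono_set N k. c \<alpha> * (\<Prod>i<N. z i ^ \<alpha> i))"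
    using f by (rule poly_fun_expand)
  obtain d where d: "g = (\<lambda>z. \<Sum>\<alpha>\<in>mono_set N l. d \<alpha> * (\<Prod>i<N. z i ^ \<alpha> i))"
    using g by (rule poly_fun_expand)
  have "poly_fun N (k + l) (\<lambda>z. (\<Prod>i<N. z i ^ \<alpha> i) * (\<Prod>i<N. z i ^ \<beta> i))"
    if "\<alpha> \<in> mono_set N k" "\<beta> \<in> mono_set N l" for \<alpha> \<beta>
  proof -
    have "(\<lambda>i. \<alpha> i + \<beta> i) \<in> mono_set N (k + l)" using that by (auto simp: mono_set_def sum.distrib)
    from poly_fun_monomial[OF this] show ?thesis by (simp add: power_add prod.distrib)
  qed
  then have "poly_fun N (k + l) (\<lambda>z. \<Sum>\<alpha>\<in>mono_set N k. \<Sum>\<beta>\<in>mono_set N l.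
      (c \<alpha> * d \<beta>) * ((\<Prod>i<N. z i ^ \<alpha> i) * (\<Prod>i<N. z i ^ \<beta> i)))"
    by (intro poly_fun_sum poly_fun_scale)
  then show ?thesis unfolding c d by (simp add: sum_product mult_ac)
qed

lemma poly_fun_const:
  assumes "k \<ge> 0" shows "poly_fun N k (\<lambda>_. c)"
  using poly_fun_scale[OF poly_fun_monomial[of "\<lambda>_. 0" N k], of c] assms by (simp add: mono_set_def)

lemma poly_fun_coordinate:
  assumes "i < N" shows "poly_fun N 1 (\<lambda>z. z i)"
proof -
  let ?a = "\<lambda>j. if j = i then 1 else 0 :: nat"
  have "?a \<in> mono_set N 1" using assms by (auto simp: mono_set_def simp del: of_nat_sum)
  moreover have "(\<Prod>j<N. z j ^ ?a j) = z i" for z :: "nat \<Rightarrow> real"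
  proof -
    have "(\<Prod>j<N. z j ^ ?a j) = (\<Prod>j\<in>{i}. z j ^ ?a j)"
      using assms by (intro prod.mono_neutral_right) auto
    then show ?thesis by simp
  qed
  ultimately show ?thesis using poly_fun_monomial[of ?a N 1] by simp
qed

definition polys :: "nat \<Rightarrow> ((nat \<Rightarrow> real) \<Rightarrow> real) set" where
  "polys N = {f. \<exists>k. poly_fun N k f}"

lemma polys_algebra: "function_algebra (polys N)"
proof
  fix f g :: "(nat \<Rightarrow> real) \<Rightarrow> real" assume "f \<in> polys N" "g \<in> polys N"
  then obtain k l where k: "poly_fun N k f" "poly_fun N l g" by (auto simp: polys_def)
  then have "poly_fun N (max k l) f" "poly_fun N (max k l) g" by (auto elim: poly_fun_weaken)
  then show "(\<lambda>z. f z + g z) \<in> polys N" by (auto simp: polys_def intro: poly_fun_add)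
  show "(\<lambda>z. f z * g z) \<in> polys N" using poly_fun_mult[OF k] by (auto simp: polys_def)
qed (use poly_fun_const[of 0] in \<open>auto simp: polys_def\<close>)

lemma polys_coordinate: "i < N \<Longrightarrow> (\<lambda>z. z i) \<in> polys N"
  using poly_fun_coordinate by (auto simp: polys_def)

lemma polys_mono: "N \<le> N' \<Longrightarrow> polys N \<subseteq> polys N'"
  using poly_fun_weaken[OF _ _ order_refl] unfolding polys_def by blast

text \<open>The polynomials satisfying \<open>P\<close> form a function algebra containing the
  coordinates, hence contain every monomial sum.\<close>

lemma polys_induct [consumes 1, case_names const coordinate add mult]:
  assumes f: "f \<in> polys N" and c: "\<And>c. P (\<lambda>_. c)" and x: "\<And>i. i < N \<Longrightarrow> P (\<lambda>z. z i)"
    and a: "\<And>f g. f \<in> polys N \<Longrightarrow> g \<in> polys N \<Longrightarrow> P f \<Longrightarrow> P g \<Longrightarrow> P (\<lambda>z. f z + g z)"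
    and m: "\<And>f g. f \<in> polys N \<Longrightarrow> g \<in> polys N \<Longrightarrow> P f \<Longrightarrow> P g \<Longrightarrow> P (\<lambda>z. f z * g z)"
  shows "P f"
proof -
  interpret function_algebra "polys N" by (rule polys_algebra)
  interpret B: function_algebra "{f \<in> polys N. P f}"
    by standard (auto intro: closed c a m)
  obtain k where "poly_fun N k f" using f by (auto simp: polys_def)
  then obtain d where "f = (\<lambda>z. \<Sum>\<alpha>\<in>mono_set N k. d \<alpha> * (\<Prod>i<N. z i ^ \<alpha> i))" by (rule poly_fun_expand)
  moreover have "(\<lambda>z. \<Sum>\<alpha>\<in>mono_set N k. d \<alpha> * (\<Prod>i<N. z i ^ \<alpha> i)) \<in> {f \<in> polys N. P f}"
    by (intro B.sum B.scale B.prod B.power) (auto intro: polys_coordinate x)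
  ultimately show ?thesis by simp
qed

lemma polys_cong: "f \<in> polys N \<Longrightarrow> (\<And>i. i < N \<Longrightarrow> z i = z' i) \<Longrightarrow> f z = f z'"
  by (induction rule: polys_induct) auto

lemma polys_continuous: "f \<in> polys N \<Longrightarrow> continuous_on S f"
proof (induction rule: polys_induct)
  case (coordinate i)
  show ?case by (rule continuous_on_subset[OF continuous_on_product_coordinates]) simp
qed (auto intro: continuous_intros)

lemma polys_measurable: "f \<in> polys N \<Longrightarrow> f \<in> borel_measurable (Leb N)"
proof (induction rule: polys_induct)
  case (coordinate i)
  then show ?case unfolding Leb_def
    using measurable_component_singleton[of i "{..<N}" "\<lambda>_. lborel :: real measure"] by simp
qed auto

text \<open>Both sides are algebra homomorphisms in \<open>f\<close> that agree on the
  coordinates.\<close>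

lemma character_polys:
  assumes "function_algebra.character (polys N) \<phi>" "f \<in> polys N"
  shows "\<phi> f = f (\<lambda>i. \<phi> (\<lambda>z. z i))"
proof -
  interpret function_algebra "polys N" by (rule polys_algebra)
  show ?thesis using assms(2,1) by (induction rule: polys_induct) (auto simp: character_def)
qed

section \<open>Sums of squares with degree bounds\<close>

lemma sos_weaken: "sos N k f \<Longrightarrow> k \<le> k' \<Longrightarrow> sos N k' f"
  using poly_fun_weaken unfolding sos_def by blast

lemma sos_zero: "sos N k (\<lambda>_. 0)"
  unfolding sos_def by (intro exI[of _ "[]"]) auto

lemma sos_one: "k \<ge> 0 \<Longrightarrow> sos N k (\<lambda>_. 1)"
  unfolding sos_def by (intro exI[of _ "[\<lambda>_. 1]"]) (auto intro: poly_fun_const)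

lemma sos_add: "sos N k f \<Longrightarrow> sos N k g \<Longrightarrow> sos N k (\<lambda>z. f z + g z)"
  unfolding sos_def
proof (elim exE conjE)
  fix fs gs assume "\<forall>h\<in>set fs. poly_fun N k h" "\<forall>z. f z = (\<Sum>h\<leftarrow>fs. (h z)\<^sup>2)"
    "\<forall>h\<in>set gs. poly_fun N k h" "\<forall>z. g z = (\<Sum>h\<leftarrow>gs. (h z)\<^sup>2)"
  then show "\<exists>hs. (\<forall>h\<in>set hs. poly_fun N k h) \<and> (\<forall>z. f z + g z = (\<Sum>h\<leftarrow>hs. (h z)\<^sup>2))"
    by (intro exI[of _ "fs @ gs"]) auto
qed

text \<open>The index of \<open>sos\<close> bounds the degree of the polynomials being squared, so
  the factor \<open>g^2\<close> raises it by \<open>e\<close> and not by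
  \<open>2 * e\<close>.\<close>

lemma sos_square_mult:
  assumes "sos N k f" "poly_fun N e g"
  shows "sos N (k + e) (\<lambda>z. (g z)\<^sup>2 * f z)"
proof -
  obtain fs where fs: "\<forall>h\<in>set fs. poly_fun N k h" "\<forall>z. f z = (\<Sum>h\<leftarrow>fs. (h z)\<^sup>2)"
    using assms(1) by (auto simp: sos_def)
  show ?thesis unfolding sos_def
  proof (intro exI[of _ "map (\<lambda>h z. h z * g z) fs"] conjI ballI allI)
    fix h assume "h \<in> set (map (\<lambda>h z. h z * g z) fs)"
    then show "poly_fun N (k + e) h" using fs(1) assms(2) by (auto intro: poly_fun_mult)
  next
    show "(g z)\<^sup>2 * f z = (\<Sum>h\<leftarrow>map (\<lambda>h z. h z * g z) fs. (h z)\<^sup>2)" for z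
      using fs(2) by (simp add: o_def power_mult_distrib sum_list_mult_const mult.commute)
  qed
qed

lemma sos_nonneg: "sos N k f \<Longrightarrow> f z \<ge> 0"
  by (auto simp: sos_def intro!: sum_list_nonneg)

section \<open>Roots of real polynomials\<close>

text \<open>Expand the product over the subsets of \<open>{1..m}\<close> and collect those of equal
  cardinality.\<close>

lemma vieta:
  fixes s :: "nat \<Rightarrow> 'a::comm_ring_1"
  shows "(\<Prod>l\<in>{1..m}. X - s l) =
    (\<Sum>k\<le>m. (-1) ^ k * (\<Sum>S\<in>{S. S \<subseteq> {1..m} \<and> card S = k}. \<Prod>l\<in>S. s l) * X ^ (m - k))"
proof -
  have "(\<Prod>l\<in>{1..m}. X - s l) = (\<Sum>S\<in>Pow {1..m}. (-1) ^ card S * (\<Prod>l\<in>S. s l) * X ^ (m - card S))"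
    by (subst prod_diff_conv_sum) (auto simp: card_Diff_subset finite_subset intro!: sum.cong)
  also have "\<dots> = (\<Sum>k\<le>m. \<Sum>S\<in>{S \<in> Pow {1..m}. card S = k}. (-1) ^ card S * (\<Prod>l\<in>S. s l) * X ^ (m - card S))"
    by (rule sum.group[symmetric]) (auto dest: card_mono[rotated])
  also have "\<dots> = (\<Sum>k\<le>m. (-1) ^ k * (\<Sum>S\<in>{S. S \<subseteq> {1..m} \<and> card S = k}. \<Prod>l\<in>S. s l) * X ^ (m - k))"
    by (intro sum.cong refl) (simp add: sum_distrib_left sum_distrib_right)
  finally show ?thesis .
qed

lemma proots_prod_linear: "proots (\<Prod>x\<in>#A. [:- x, 1:]) = (A :: 'a::idom multiset)"
proof (induction A)
  case (add x A)
  have "(\<Prod>x\<in>#A. [:- x, 1:]) \<noteq> (0 :: 'a poly)" by (auto simp: prod_mset_zero_iff)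
  then show ?case using add by (simp add: proots_mult del: mult_pCons_left)
qed simp

lemma poly_prod_linear: "poly (\<Prod>x\<in>#A. [:- x, 1:]) X = (\<Prod>x\<in>#A. X - x)"
  for X :: "'a::comm_ring_1"
  by (induction A) (auto simp: algebra_simps)

text \<open>The monic polynomial with the conjugated roots takes the same values as
  \<open>P\<close>, so it is \<open>P\<close>. Working with multisets keeps track of
  multiplicities.\<close>

lemma proots_cnj_invariant:
  fixes P :: "complex poly"
  assumes lead: "lead_coeff P = 1" and cnj: "\<And>X. poly P (cnj X) = cnj (poly P X)"
  shows "image_mset cnj (proots P) = proots P"
proof -
  have P: "(\<Prod>x\<in>#proots P. [:- x, 1:]) = P"
    using complex_poly_decompose_multiset[of P] lead by simp
  have "poly (\<Prod>x\<in>#image_mset cnj (proots P). [:- x, 1:]) X = poly P X" for X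
  proof -
    have "poly (\<Prod>x\<in>#image_mset cnj (proots P). [:- x, 1:]) X = (\<Prod>x\<in>#proots P. X - cnj x)"
      unfolding poly_prod_linear by (simp only: image_mset.compositionality o_def)
    also have "\<dots> = cnj (\<Prod>x\<in>#proots P. cnj X - x)"
    proof -
      have "(\<Prod>x\<in>#B. X - cnj x) = cnj (\<Prod>x\<in>#B. cnj X - x)" for B
        by (induction B) auto
      then show ?thesis .
    qed
    also have "\<dots> = cnj (poly P (cnj X))" by (subst (2) P[symmetric]) (simp only: poly_prod_linear)
    finally show ?thesis by (simp add: cnj)
  qed
  then have "(\<Prod>x\<in>#image_mset cnj (proots P). [:- x, 1:]) = P"
    by (intro poly_eq_poly_eq_iff[THEN iffD1] ext)
  then show ?thesis by (metis proots_prod_linear)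
qed

section \<open>Pairing the roots of a real polynomial\<close>

lemma insert_Diff_twice_mset:
  assumes "s \<in># A" "t \<in># A - {#s#}"
  shows "A = add_mset s (add_mset t (A - {#s#} - {#t#}))"
  using assms by (metis insert_DiffM)

definition cnj_invariant :: "complex multiset \<Rightarrow> bool" where
  "cnj_invariant A \<longleftrightarrow> image_mset cnj A = A"

lemma cnj_invariant_remove_real:
  assumes "cnj_invariant A" "s \<in># A" "Im s = 0"
  shows "cnj_invariant (A - {#s#})"
proof -
  have "cnj s = s" using assms by (simp add: complex_eq_iff)
  then show ?thesis using assms by (simp add: cnj_invariant_def image_mset_Diff)
qed

lemma cnj_invariant_remove_pair:
  assumes A: "cnj_invariant A" "s \<in># A" "Im s \<noteq> 0"
  shows "cnj s \<in># A - {#s#}" "cnj_invariant (A - {#s#} - {#cnj s#})"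
proof -
  have "cnj s \<in># image_mset cnj A" using A by auto
  then have "cnj s \<in># A" using A(1) unfolding cnj_invariant_def by metis
  moreover have "cnj s \<noteq> s" using A by (simp add: complex_eq_iff)
  ultimately show c: "cnj s \<in># A - {#s#}" by (simp add: in_diff_count)
  define B where "B = A - {#s#} - {#cnj s#}"
  have AB: "A = add_mset s (add_mset (cnj s) B)" unfolding B_def by (rule insert_Diff_twice_mset[OF A(2) c])
  have "image_mset cnj B = B" using A(1) unfolding cnj_invariant_def AB by (simp add: add_mset_commute)
  then show "cnj_invariant (A - {#s#} - {#cnj s#})" unfolding B_def[symmetric] by (simp add: cnj_invariant_def)
qed

text \<open>Nonreal elements can be removed in conjugate pairs without changing the parity, so a
  real one must remain.\<close>

lemma cnj_invariant_odd_real: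
  assumes "cnj_invariant A" "odd (size A)"
  obtains r where "r \<in># A" "Im r = 0"
proof -
  have "\<exists>r\<in>#A. Im r = 0" using assms
  proof (induction "size A" arbitrary: A rule: less_induct)
    case less
    then obtain s where s: "s \<in># A" by (cases A) auto
    show ?case
    proof (cases "Im s = 0")
      case False
      note B = cnj_invariant_remove_pair[OF less(2) s False]
      let ?B = "A - {#s#} - {#cnj s#}"
      have "size A = size ?B + 2" using s B(1)
        by (metis add_2_eq_Suc' insert_DiffM size_add_mset)
      then have "\<exists>r\<in>#?B. Im r = 0" using less(1)[of ?B] B(2) less(3) by simp
      then show ?thesis by (meson in_diffD)
    qed (use s in auto)
  qed
  then show ?thesis using that by auto
qed

text \<open>A nonreal \<open>s\<close> is paired with its conjugate. If \<open>s\<close> is real, an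
  odd number of elements remains, so another real one is available as partner.\<close>

lemma cnj_invariant_partner:
  assumes A: "cnj_invariant A" "even (size A)" "s \<in># A"
  obtains t where "t \<in># A - {#s#}" "Im t = - Im s" "cnj_invariant (A - {#s#} - {#t#})"
proof (cases "Im s = 0")
  case False
  then show ?thesis using cnj_invariant_remove_pair[OF A(1,3)] that by auto
next
  case True
  note B = cnj_invariant_remove_real[OF A(1,3) True]
  have "odd (size (A - {#s#}))" using A(2,3) by (metis even_Suc insert_DiffM size_add_mset)
  then obtain t where t: "t \<in># A - {#s#}" "Im t = 0" using cnj_invariant_odd_real[OF B] by blast
  then show ?thesis using cnj_invariant_remove_real[OF B t] True that by auto
qed

text \<open>Positions are counted from 0, so the entries \<open>2 * j\<close> and
  \<open>2 * j + 1\<close> carry the indices \<open>2 * j + 1\<close> and \<open>2 * j + 2\<close>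
  of the relations between the \<open>y\<close> variables.\<close>

fun paired :: "complex list \<Rightarrow> bool" where
  "paired [] = True"
| "paired [x] = False"
| "paired (x # y # xs) = (Im x = - Im y \<and> paired xs)"

lemma paired_append: "paired xs \<Longrightarrow> paired ys \<Longrightarrow> paired (xs @ ys)"
  by (induction xs rule: paired.induct) auto

lemma paired_nth: "paired xs \<Longrightarrow> 2 * j + 1 < length xs \<Longrightarrow> Im (xs ! (2 * j)) = - Im (xs ! (2 * j + 1))"
proof (induction xs arbitrary: j rule: paired.induct)
  case (3 x y xs)
  then show ?case by (cases j) auto
qed auto

lemma paired_enumeration:
  assumes "cnj_invariant A" "even (size A)"
  obtains xs where "mset xs = A" "paired xs"
proof -
  have "\<exists>xs. mset xs = A \<and> paired xs" using assms
  proof (induction "size A" arbitrary: A rule: less_induct)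
    case less
    show ?case
    proof (cases "A = {#}")
      case False
      then obtain s where s: "s \<in># A" by auto
      obtain t where t: "t \<in># A - {#s#}" "Im t = - Im s" "cnj_invariant (A - {#s#} - {#t#})"
        using cnj_invariant_partner[OF less(2,3) s] by blast
      let ?B = "A - {#s#} - {#t#}"
      have sz: "size A = size ?B + 2" using s t(1)
        by (metis add_2_eq_Suc' insert_DiffM size_add_mset)
      then obtain xs where "mset xs = ?B" "paired xs" using less(1)[of ?B] t(3) less(3) by auto
      then have "mset (s # t # xs) = A" "paired (s # t # xs)"
        using insert_Diff_twice_mset[OF s t(1)] t(2) by (metis mset.simps(2), simp)
      then show ?thesis by blast
    qed (auto intro: exI[of _ "[]"])
  qed
  then show ?thesis using that by auto
qed

text \<open>A root \<open>a\<close> of largest real part must come last while all relations encoded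
  in \<open>yfull\<close> hold. For even \<open>m\<close>, it closes the last pair. For odd
  \<open>m \<ge> 3\<close>, the last three imaginary parts must sum to 0: a real \<open>a\<close> is
  preceded by some pair, a nonreal \<open>a\<close> by its conjugate and a real root. The rest is
  even in number and is listed in pairs.\<close>

lemma root_arrangement:
  fixes c :: "nat \<Rightarrow> real"
  assumes m: "m \<ge> 1" and cm: "c m = 1"
  obtains s yt where "\<And>X. (\<Sum>k\<le>m. complex_of_real (c k) * X ^ k) = (\<Prod>l\<in>{1..m}. X - s l)"
    "\<And>l. l \<in> {1..m} \<Longrightarrow> Re (s l) \<le> Re (s m)"
    "\<And>l. l \<in> {1..m} \<Longrightarrow> Im (s l) = yfull m yt l"
proof -
  note result = that
  define P where "P = (\<Sum>k\<le>m. monom (complex_of_real (c k)) k)"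
  have Pp: "poly P X = (\<Sum>k\<le>m. complex_of_real (c k) * X ^ k)" for X
    by (simp add: P_def poly_sum poly_monom)
  have coeff: "coeff P k = (if k \<le> m then complex_of_real (c k) else 0)" for k
    by (simp add: P_def coeff_sum)
  have deg: "degree P = m"
    by (rule antisym) (auto simp: coeff cm intro!: degree_le le_degree)
  have lead: "lead_coeff P = 1" by (simp add: deg coeff cm)
  define A where "A = proots P"
  have A: "cnj_invariant A" "size A = m"
    using proots_cnj_invariant[OF lead] by (auto simp: cnj_invariant_def A_def size_proots_complex deg Pp)
  have Aprod: "poly P X = (\<Prod>x\<in>#A. X - x)" for X
    using complex_poly_decompose_multiset[of P] lead poly_prod_linear[of A X] by (simp add: A_def)
  have "set_mset A \<noteq> {}" using A(2) m by auto
  then have "Max (Re ` set_mset A) \<in> Re ` set_mset A" by (intro Max_in) auto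
  then obtain a where a: "a \<in># A" and "Re a = Max (Re ` set_mset A)" by auto
  then have amax: "\<And>x. x \<in># A \<Longrightarrow> Re x \<le> Re a" by simp
  \<comment> \<open>It remains to find a list of the roots that ends in \<open>a\<close> and whose
    imaginary parts have the form \<open>yfull\<close>; root \<open>l\<close> sits at position
    \<open>l - 1\<close>.\<close>
  have *: thesis if xs: "mset xs = A" "last xs = a"
    and y: "\<And>l. l \<in> {1..m} \<Longrightarrow> Im (xs ! (l - 1)) = yfull m yt l" for xs yt
  proof (rule result[of "\<lambda>l. xs ! (l - 1)" yt])
    have len: "length xs = m" using A(2) xs(1) by (metis size_mset)
    have sa: "xs ! (m - 1) = a" using last_conv_nth[of xs] len m xs(2) by fastforce
    show "(\<Sum>k\<le>m. complex_of_real (c k) * X ^ k) = (\<Prod>l\<in>{1..m}. X - xs ! (l - 1))" for X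
    proof -
      have "(\<Sum>k\<le>m. complex_of_real (c k) * X ^ k) = prod_mset (mset (map (\<lambda>x. X - x) xs))"
        using Aprod[of X] Pp[of X] xs(1) by simp
      also have "\<dots> = (\<Prod>i<m. X - xs ! i)"
        unfolding prod_mset_prod_list by (simp add: prod.list_conv_set_nth len atLeast0LessThan)
      also have "\<dots> = (\<Prod>l\<in>{1..m}. X - xs ! (l - 1))"
        by (rule prod.reindex_bij_witness[of _ "\<lambda>l. l - 1" Suc]) auto
      finally show ?thesis .
    qed
    show "Re (xs ! (l - 1)) \<le> Re (xs ! (m - 1))" if "l \<in> {1..m}" for l
    proof -
      have "l - 1 < length xs" using that len by auto
      then have "xs ! (l - 1) \<in># A" using nth_mem xs(1) by fastforce
      then show ?thesis unfolding sa by (rule amax)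
    qed
    show "Im (xs ! (l - 1)) = yfull m yt l" if "l \<in> {1..m}" for l using y[OF that] .
  qed
  show thesis
  proof (cases "even m")
    case True
    obtain t where t: "t \<in># A - {#a#}" "Im t = - Im a" "cnj_invariant (A - {#a#} - {#t#})"
      using cnj_invariant_partner[OF A(1) _ a] A(2) True by blast
    have "size A = size (A - {#a#} - {#t#}) + 2" using a t(1)
      by (metis add_2_eq_Suc' insert_DiffM size_add_mset)
    then have "even (size (A - {#a#} - {#t#}))" using A(2) True by simp
    then obtain xs where xs: "mset xs = A - {#a#} - {#t#}" "paired xs"
      using paired_enumeration[OF t(3)] by blast
    let ?xs = "xs @ [t, a]"
    have ms: "mset ?xs = A" using xs(1) insert_Diff_twice_mset[OF a t(1)] by (simp add: add_mset_commute)
    then have len: "length ?xs = m" using A(2) by (metis size_mset)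
    have p: "paired ?xs" using xs(2) t(2) by (intro paired_append) auto
    show thesis
    proof (rule *[OF ms, of "\<lambda>j. Im (?xs ! (2 * j + 1))"])
      fix l assume l: "l \<in> {1..m}"
      show "Im (?xs ! (l - 1)) = yfull m (\<lambda>j. Im (?xs ! (2 * j + 1))) l"
      proof (cases "even l")
        case True
        then obtain j where "l = 2 * j" by blast
        with l obtain i where "l = 2 * i + 2" by (cases j) auto
        then show ?thesis using \<open>even m\<close> by (simp add: yfull_def)
      next
        case False
        then obtain i where i: "l = 2 * i + 1" by (auto elim: oddE)
        have "l \<noteq> m" using False \<open>even m\<close> by auto
        then have "2 * i + 1 < length ?xs" using l i len by simp
        from paired_nth[OF p this] show ?thesis using \<open>even m\<close> i by (simp add: yfull_def)
      qed
    qed simp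
  next
    case odd: False
    show thesis
    proof (cases "m = 1")
      case True
      then have "size A = 1" using A by simp
      then obtain a' where "A = {#a'#}" using size_1_singleton_mset by blast
      then have "A = {#a#}" using a by simp
      then show thesis using True by (intro *[of "[a]" "\<lambda>_. Im a"]) (auto simp: yfull_def)
    next
      case False
      then have m3: "m \<ge> 3" using odd m by presburger
      \<comment> \<open>The sum condition is the relation that \<open>yfull\<close> imposes on the
        indices \<open>m - 2\<close>, \<open>m - 1\<close> and \<open>m\<close>.\<close>
      obtain xs b d where xs: "mset (xs @ [b, d, a]) = A" "paired xs" "Im b + Im d + Im a = 0"
      proof (cases "Im a = 0")
        case True
        note B = cnj_invariant_remove_real[OF A(1) a True]
        have szB: "size (A - {#a#}) = m - 1" using a A(2) by (simp add: size_Diff_singleton)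
        have evB: "even (size (A - {#a#}))" unfolding szB using odd m by auto
        have "A - {#a#} \<noteq> {#}" using szB m3 by auto
        then obtain b where b: "b \<in># A - {#a#}" by auto
        obtain d where d: "d \<in># A - {#a#} - {#b#}" "Im d = - Im b" "cnj_invariant (A - {#a#} - {#b#} - {#d#})"
          using cnj_invariant_partner[OF B evB b] by blast
        have AB: "A = add_mset a (add_mset b (add_mset d (A - {#a#} - {#b#} - {#d#})))"
          using insert_Diff_twice_mset[OF a b] insert_DiffM[OF d(1)] by metis
        have "size (A - {#a#} - {#b#} - {#d#}) = m - 3"
          using arg_cong[OF AB, of size] A(2) unfolding size_add_mset by linarith
        moreover have "even (m - 3)" using odd m3 by auto
        ultimately obtain xs where "mset xs = A - {#a#} - {#b#} - {#d#}" "paired xs"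
          using paired_enumeration[OF d(3)] by auto
        with AB show ?thesis using d True by (intro that[of xs b d]) (auto simp: add_mset_commute)
      next
        case False
        note B = cnj_invariant_remove_pair[OF A(1) a False]
        have szB: "size (A - {#a#} - {#cnj a#}) = m - 2"
          using arg_cong[OF insert_Diff_twice_mset[OF a B(1)], of size] A(2) unfolding size_add_mset by linarith
        have oddB: "odd (size (A - {#a#} - {#cnj a#}))" unfolding szB using odd m3 by auto
        obtain d where d: "d \<in># A - {#a#} - {#cnj a#}" "Im d = 0"
          using cnj_invariant_odd_real[OF B(2) oddB] by blast
        note C = cnj_invariant_remove_real[OF B(2) d]
        have AB: "A = add_mset a (add_mset (cnj a) (add_mset d (A - {#a#} - {#cnj a#} - {#d#})))"
          using insert_Diff_twice_mset[OF a B(1)] insert_DiffM[OF d(1)] by metis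
        have "size (A - {#a#} - {#cnj a#} - {#d#}) = m - 3"
          using arg_cong[OF AB, of size] A(2) unfolding size_add_mset by linarith
        moreover have "even (m - 3)" using odd m3 by auto
        ultimately obtain xs where "mset xs = A - {#a#} - {#cnj a#} - {#d#}" "paired xs"
          using paired_enumeration[OF C] by auto
        with AB show ?thesis using d by (intro that[of xs "cnj a" d]) (auto simp: add_mset_commute)
      qed
      let ?xs = "xs @ [b, d, a]"
      have "length ?xs = m" using A(2) xs(1) by (metis size_mset)
      then have len: "length xs + 3 = m" by simp
      then have "even (length xs)" using odd by auto
      then obtain i0 where i0: "m = 2 * i0 + 3" using len by (metis evenE)
      show thesis
      \<comment> \<open>Here \<open>m = 2 * i0 + 3\<close>, so the free variable of index
        \<open>i0 + 1\<close> is the imaginary part of \<open>a\<close> itself; the formula for the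
        even-indexed roots would point beyond the list there.\<close>
      proof (rule *[OF xs(1), of "\<lambda>j. if j = i0 + 1 then Im a else Im (?xs ! (2 * j + 1))"])
        fix l assume l: "l \<in> {1..m}"
        have len': "length xs = 2 * i0" using len i0 by simp
        consider "l = m" | "l = m - 1" | "l = m - 2" | "l \<le> 2 * i0" using l i0 by fastforce
        then show "Im (?xs ! (l - 1)) = yfull m (\<lambda>j. if j = i0 + 1 then Im a else Im (?xs ! (2 * j + 1))) l"
        proof cases
          case 4
          show ?thesis
          proof (cases "even l")
            case True
            then obtain j where "l = 2 * j" by blast
            with l obtain i where "l = 2 * i + 2" by (cases j) auto
            then show ?thesis using odd i0 4 by (auto simp: yfull_def)
          next
            case False
            then obtain i where i: "l = 2 * i + 1" by (auto elim: oddE)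
            then have lt: "2 * i + 1 < length xs" using 4 len' by presburger
            from paired_nth[OF xs(2) lt] show ?thesis using odd i0 lt i len'
              by (auto simp: yfull_def nth_append)
          qed
        qed (use odd i0 len' xs(3) in \<open>auto simp: yfull_def nth_append nth_Cons'\<close>)
      qed simp
    qed
  qed
qed

section \<open>The quadratic module of the program\<close>

text \<open>Besides closure, membership in \<open>polys\<close> records that only the
  \<open>nfree m\<close> free variables are read, which \<open>K_surjective\<close> exploits through
  \<open>polys_cong\<close>.\<close>

lemma yfull_polys:
  assumes "l \<in> {1..m}" "a + nfree m \<le> N"
  shows "(\<lambda>z. yfull m (\<lambda>j. z (a + j)) l) \<in> polys N"
proof -
  interpret function_algebra "polys N" by (rule polys_algebra)
  have *: "(\<lambda>z. z (a + j)) \<in> polys N" if "j < nfree m" for j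
    using assms that by (intro polys_coordinate) auto
  consider "even m" | "m = 1" | "odd m" "m \<noteq> 1" by blast
  then show ?thesis
  proof cases
    case 1
    have "(l + 1) div 2 - 1 < nfree m" "l div 2 - 1 < nfree m"
      using assms by (auto simp: nfree_def)
    then show ?thesis using 1 by (cases "even l") (auto simp: yfull_def intro!: * minus)
  next
    case 2
    then show ?thesis using * by (simp add: yfull_def nfree_def)
  next
    case 3
    have "(m - 1) div 2 < nfree m" "l div 2 - 1 < nfree m" "(m - 1) div 2 - 1 < nfree m" "(l + 1) div 2 - 1 < nfree m"
      using assms 3 by (auto simp: nfree_def)
    then show ?thesis using 3 odd_pos[OF 3(1)]
      by (cases "l = m"; cases "even l"; cases "l = m - 2") (auto simp: yfull_def intro!: * minus diff)
  qed
qed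

text \<open>Each free variable is the imaginary part of some \<open>svar\<close>, so a bound on the
  moduli of the roots bounds it.\<close>

lemma free_variable_yfull:
  assumes "j < nfree m"
  obtains l where "l \<in> {1..m}" "\<forall>yt. yfull m yt l = yt j"
proof -
  consider "even m" | "m = 1" | "odd m" "m \<noteq> 1" "j = (m - 1) div 2" | "odd m" "m \<noteq> 1" "j \<noteq> (m - 1) div 2" by blast
  then show ?thesis
  proof cases
    case 1
    then show ?thesis using assms by (intro that[of "2 * j + 2"]) (auto simp: yfull_def nfree_def)
  next
    case 2
    then show ?thesis using assms by (intro that[of 1]) (auto simp: yfull_def nfree_def)
  next
    case 3
    then show ?thesis using assms by (intro that[of m]) (auto simp: yfull_def nfree_def Suc_le_eq odd_pos)
  next
    case 4
    then have "2 * j + 2 < m" using assms by (auto simp: nfree_def elim!: oddE)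
    then show ?thesis using 4 assms by (intro that[of "2 * j + 2"]) (auto simp: yfull_def nfree_def)
  qed
qed

section \<open>Certificates of the program and the quadratic module they form\<close>

locale abscissa_program =
  fixes n m :: nat and p :: "nat \<Rightarrow> (nat \<Rightarrow> real) \<Rightarrow> real"
  assumes m: "m \<ge> 1" and p_polys: "\<And>k. k < m \<Longrightarrow> p k \<in> polys n" and monic: "p m = (\<lambda>_. 1)"
begin

abbreviation N :: nat where "N \<equiv> n + m + nfree m"

sublocale function_algebra "polys N" by (rule polys_algebra)

definition hR :: "nat \<Rightarrow> (nat \<Rightarrow> real) \<Rightarrow> real" where
  "hR k z = (-1) ^ k * p (m - k) z - Rk n m k z"

definition combination ::
  "((nat \<Rightarrow> real) \<Rightarrow> real) \<Rightarrow> (nat \<Rightarrow> (nat \<Rightarrow> real) \<Rightarrow> real) \<Rightarrow> (nat \<Rightarrow> (nat \<Rightarrow> real) \<Rightarrow> real) \<Rightarrow>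
   (nat \<Rightarrow> (nat \<Rightarrow> real) \<Rightarrow> real) \<Rightarrow> (nat \<Rightarrow> (nat \<Rightarrow> real) \<Rightarrow> real) \<Rightarrow> (nat \<Rightarrow> real) \<Rightarrow> real" where
  "combination \<sigma>0 \<sigma> \<sigma>x \<tau>R \<tau>I z = \<sigma>0 z
     + (\<Sum>j\<in>{1..n}. \<sigma> j z * (1 - (z (j - 1))\<^sup>2))
     + (\<Sum>k\<in>{1..m-1}. \<sigma>x k z * (z (n + m - 1) - z (n + k - 1)))
     + (\<Sum>k\<in>{1..m}. \<tau>R k z * hR k z)
     + (\<Sum>k\<in>{1..m}. \<tau>I k z * Ik n m k z)"

definition multipliers ::
  "nat \<Rightarrow> ((nat \<Rightarrow> real) \<Rightarrow> real) \<Rightarrow> (nat \<Rightarrow> (nat \<Rightarrow> real) \<Rightarrow> real) \<Rightarrow> (nat \<Rightarrow> (nat \<Rightarrow> real) \<Rightarrow> real) \<Rightarrow>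
   (nat \<Rightarrow> (nat \<Rightarrow> real) \<Rightarrow> real) \<Rightarrow> (nat \<Rightarrow> (nat \<Rightarrow> real) \<Rightarrow> real) \<Rightarrow> bool" where
  "multipliers d \<sigma>0 \<sigma> \<sigma>x \<tau>R \<tau>I \<longleftrightarrow>
     sos N (int d) \<sigma>0 \<and>
     (\<forall>j\<in>{1..n}. sos N (int d - 1) (\<sigma> j)) \<and>
     (\<forall>k\<in>{1..m-1}. sos N (int d) (\<sigma>x k)) \<and>
     (\<forall>k\<in>{1..m}. poly_fun N (2 * int d - int k) (\<tau>R k) \<and> poly_fun N (2 * int d - int k) (\<tau>I k))"

definition certified :: "nat \<Rightarrow> ((nat \<Rightarrow> real) \<Rightarrow> real) \<Rightarrow> bool" where
  "certified d f \<longleftrightarrow> (\<exists>\<sigma>0 \<sigma> \<sigma>x \<tau>R \<tau>I. multipliers d \<sigma>0 \<sigma> \<sigma>x \<tau>R \<tau>I \<and>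
     (\<forall>z. f z = combination \<sigma>0 \<sigma> \<sigma>x \<tau>R \<tau>I z))"

lemma feasible_iff_certified:
  "feasible n m p d w \<longleftrightarrow> poly_fun n (2 * int d) w \<and> certified d (\<lambda>z. z (n + m - 1) - w z)"
  unfolding feasible_def certified_def multipliers_def combination_def hR_def by (simp only: conj_assoc)

lemma certifiedI:
  "multipliers d \<sigma>0 \<sigma> \<sigma>x \<tau>R \<tau>I \<Longrightarrow> (\<And>z. f z = combination \<sigma>0 \<sigma> \<sigma>x \<tau>R \<tau>I z) \<Longrightarrow> certified d f"
  unfolding certified_def by blast

lemma certifiedE:
  assumes "certified d f"
  obtains \<sigma>0 \<sigma> \<sigma>x \<tau>R \<tau>I where "multipliers d \<sigma>0 \<sigma> \<sigma>x \<tau>R \<tau>I" "f = combination \<sigma>0 \<sigma> \<sigma>x \<tau>R \<tau>I"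
  using assms unfolding certified_def fun_eq_iff[symmetric] by blast

lemma multipliers_weaken:
  assumes "multipliers d \<sigma>0 \<sigma> \<sigma>x \<tau>R \<tau>I" "d \<le> d'"
  shows "multipliers d' \<sigma>0 \<sigma> \<sigma>x \<tau>R \<tau>I"
proof -
  have le: "int d \<le> int d'" "int d - 1 \<le> int d' - 1" "2 * int d - int k \<le> 2 * int d' - int k" for k
    using assms(2) by auto
  show ?thesis using assms(1) unfolding multipliers_def
    by (meson sos_weaken poly_fun_weaken le order_refl)
qed

lemma certified_weaken: "certified d f \<Longrightarrow> d \<le> d' \<Longrightarrow> certified d' f"
  unfolding certified_def using multipliers_weaken by meson

lemma certified_add:
  assumes "certified d f" "certified d g"
  shows "certified d (\<lambda>z. f z + g z)"
proof -
  obtain \<sigma>0 \<sigma> \<sigma>x \<tau>R \<tau>I where 1: "multipliers d \<sigma>0 \<sigma> \<sigma>x \<tau>R \<tau>I" "f = combination \<sigma>0 \<sigma> \<sigma>x \<tau>R \<tau>I"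
    using assms(1) by (rule certifiedE)
  obtain \<sigma>0' \<sigma>' \<sigma>x' \<tau>R' \<tau>I' where 2: "multipliers d \<sigma>0' \<sigma>' \<sigma>x' \<tau>R' \<tau>I'" "g = combination \<sigma>0' \<sigma>' \<sigma>x' \<tau>R' \<tau>I'"
    using assms(2) by (rule certifiedE)
  show ?thesis
  proof (rule certifiedI)
    show "multipliers d (\<lambda>z. \<sigma>0 z + \<sigma>0' z) (\<lambda>j z. \<sigma> j z + \<sigma>' j z) (\<lambda>j z. \<sigma>x j z + \<sigma>x' j z)
        (\<lambda>j z. \<tau>R j z + \<tau>R' j z) (\<lambda>j z. \<tau>I j z + \<tau>I' j z)"
      using 1(1) 2(1) unfolding multipliers_def by (auto intro: sos_add poly_fun_add)
    show "f z + g z = combination (\<lambda>z. \<sigma>0 z + \<sigma>0' z) (\<lambda>j z. \<sigma> j z + \<sigma>' j z) (\<lambda>j z. \<sigma>x j z + \<sigma>x' j z)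
        (\<lambda>j z. \<tau>R j z + \<tau>R' j z) (\<lambda>j z. \<tau>I j z + \<tau>I' j z) z" for z
      unfolding 1(2) 2(2) combination_def distrib_right sum.distrib by simp
  qed
qed

lemma certified_square_mult:
  assumes "certified d f" "poly_fun N (int e) g"
  shows "certified (d + e) (\<lambda>z. (g z)\<^sup>2 * f z)"
proof -
  obtain \<sigma>0 \<sigma> \<sigma>x \<tau>R \<tau>I where 1: "multipliers d \<sigma>0 \<sigma> \<sigma>x \<tau>R \<tau>I" "f = combination \<sigma>0 \<sigma> \<sigma>x \<tau>R \<tau>I"
    using assms(1) by (rule certifiedE)
  have s: "sos N (int (d + e)) (\<lambda>z. (g z)\<^sup>2 * f z)" if "sos N (int d) f" for f
    using sos_square_mult[OF that assms(2)] by simp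
  have s': "sos N (int (d + e) - 1) (\<lambda>z. (g z)\<^sup>2 * f z)" if "sos N (int d - 1) f" for f
    using sos_square_mult[OF that assms(2)] by (simp add: algebra_simps)
  have t: "poly_fun N (2 * int (d + e) - int k) (\<lambda>z. (g z)\<^sup>2 * f z)" if "poly_fun N (2 * int d - int k) f" for f k
    using poly_fun_mult[OF poly_fun_mult[OF assms(2) assms(2)] that] by (simp add: algebra_simps power2_eq_square)
  show ?thesis
  proof (rule certifiedI)
    show "multipliers (d + e) (\<lambda>z. (g z)\<^sup>2 * \<sigma>0 z) (\<lambda>j z. (g z)\<^sup>2 * \<sigma> j z) (\<lambda>j z. (g z)\<^sup>2 * \<sigma>x j z)
        (\<lambda>j z. (g z)\<^sup>2 * \<tau>R j z) (\<lambda>j z. (g z)\<^sup>2 * \<tau>I j z)"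
      using 1(1) unfolding multipliers_def by (blast intro: s s' t)
    show "(g z)\<^sup>2 * f z = combination (\<lambda>z. (g z)\<^sup>2 * \<sigma>0 z) (\<lambda>j z. (g z)\<^sup>2 * \<sigma> j z) (\<lambda>j z. (g z)\<^sup>2 * \<sigma>x j z)
        (\<lambda>j z. (g z)\<^sup>2 * \<tau>R j z) (\<lambda>j z. (g z)\<^sup>2 * \<tau>I j z) z" for z
      unfolding 1(2) combination_def distrib_left sum_distrib_left mult.assoc by simp
  qed
qed

text \<open>Multiplying by squares raises the degree, so only the union over all levels
  \<open>d\<close> is a quadratic module.\<close>

definition M :: "((nat \<Rightarrow> real) \<Rightarrow> real) set" where
  "M = {f. \<exists>d. certified d f}"

lemma M_I: "multipliers d \<sigma>0 \<sigma> \<sigma>x \<tau>R \<tau>I \<Longrightarrow> (\<And>z. combination \<sigma>0 \<sigma> \<sigma>x \<tau>R \<tau>I z = f z) \<Longrightarrow> f \<in> M"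
  unfolding M_def using certifiedI[of d \<sigma>0 \<sigma> \<sigma>x \<tau>R \<tau>I f] by auto

lemma M_qm: "quadratic_module M"
  unfolding quadratic_module_def
proof (intro conjI ballI)
  show "(\<lambda>_. 1) \<in> M"
    by (rule M_I[of 0 "\<lambda>_. 1" "\<lambda>_ _. 0" "\<lambda>_ _. 0" "\<lambda>_ _. 0" "\<lambda>_ _. 0"])
       (auto simp: multipliers_def combination_def sos_zero sos_one poly_fun_zero)
next
  fix f g assume "f \<in> M" "g \<in> M"
  then obtain d e where "certified d f" "certified e g" by (auto simp: M_def)
  then have "certified (max d e) f" "certified (max d e) g" by (auto elim: certified_weaken)
  then show "(\<lambda>z. f z + g z) \<in> M" unfolding M_def using certified_add by blast
next
  fix g f assume "g \<in> polys N" "f \<in> M"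
  then obtain e d where "poly_fun N e g" "certified d f" by (auto simp: M_def polys_def)
  moreover from this have "poly_fun N (int (nat e)) g" by (auto elim: poly_fun_weaken)
  ultimately show "(\<lambda>z. (g z)\<^sup>2 * f z) \<in> M" unfolding M_def using certified_square_mult by blast
qed

text \<open>Level 1 is the first at which the degree bound \<open>int d - 1\<close> admits the
  constant multiplier 1. The multiplier of coordinate \<open>j\<close> has the shifted index
  \<open>Suc j\<close>.\<close>

lemma M_q: "j < n \<Longrightarrow> (\<lambda>z. 1 - (z j)\<^sup>2) \<in> M"
  by (rule M_I[of 1 "\<lambda>_. 0" "\<lambda>i _. if i = Suc j then 1 else 0" "\<lambda>_ _. 0" "\<lambda>_ _. 0" "\<lambda>_ _. 0"])
     (auto simp: multipliers_def combination_def sos_zero sos_one poly_fun_zero if_distrib[of "\<lambda>x. x * _"] cong: if_cong)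

lemma M_x: "k \<in> {1..m-1} \<Longrightarrow> (\<lambda>z. z (n + m - 1) - z (n + k - 1)) \<in> M"
  by (rule M_I[of 1 "\<lambda>_. 0" "\<lambda>_ _. 0" "\<lambda>i _. if i = k then 1 else 0" "\<lambda>_ _. 0" "\<lambda>_ _. 0"])
     (auto simp: multipliers_def combination_def sos_zero sos_one poly_fun_zero if_distrib[of "\<lambda>x. x * _"] cong: if_cong)

text \<open>At level \<open>k\<close> the degree bound of the multiplier is
  \<open>2 * k - k \<ge> 0\<close>, so a constant of either sign is allowed.\<close>

lemma M_hR: "k \<in> {1..m} \<Longrightarrow> (\<lambda>z. c * hR k z) \<in> M"
  by (rule M_I[of k "\<lambda>_. 0" "\<lambda>_ _. 0" "\<lambda>_ _. 0" "\<lambda>i _. if i = k then c else 0" "\<lambda>_ _. 0"])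
     (auto simp: multipliers_def combination_def sos_zero sos_one poly_fun_zero poly_fun_const if_distrib[of "\<lambda>x. x * _"] cong: if_cong)

lemma M_Ik: "k \<in> {1..m} \<Longrightarrow> (\<lambda>z. c * Ik n m k z) \<in> M"
  by (rule M_I[of k "\<lambda>_. 0" "\<lambda>_ _. 0" "\<lambda>_ _. 0" "\<lambda>_ _. 0" "\<lambda>i _. if i = k then c else 0"])
     (auto simp: multipliers_def combination_def sos_zero sos_one poly_fun_zero poly_fun_const if_distrib[of "\<lambda>x. x * _"] cong: if_cong)

lemma p_N: "k \<le> m \<Longrightarrow> p k \<in> polys N"
  using p_polys[of k] polys_mono[of n N] const[of 1] by (cases "k = m") (auto simp: monic)

lemma svar_closure: "l \<in> {1..m} \<Longrightarrow> (\<lambda>z. svar n m z l) \<in> complex_closure"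
  by (auto simp: complex_closure_def svar_def intro!: polys_coordinate yfull_polys)

lemma esym_closure: "(\<lambda>z. esym n m k z) \<in> complex_closure"
  unfolding esym_def by (intro complex_closure_intros svar_closure) auto

lemma hR_polys: "hR k \<in> polys N"
  unfolding hR_def[abs_def] Rk_def using esym_closure[of k] p_N[of "m - k"]
  by (intro closed) (auto simp: complex_closure_def)

lemma Ik_polys: "Ik n m k \<in> polys N"
  using esym_closure[of k] by (simp add: complex_closure_def Ik_def[abs_def])

section \<open>The constraint set: its points are the arrangements of the roots\<close>

definition K :: "(nat \<Rightarrow> real) set" where
  "K = {z. (\<forall>j<n. (z j)\<^sup>2 \<le> 1) \<and> (\<forall>k\<in>{1..m-1}. z (n + k - 1) \<le> z (n + m - 1)) \<and>
     (\<forall>k\<in>{1..m}. hR k z = 0 \<and> Ik n m k z = 0)}"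

lemma M_nonneg: "f \<in> M \<Longrightarrow> z \<in> K \<Longrightarrow> f z \<ge> 0"
proof -
  assume "f \<in> M" and z: "z \<in> K"
  then obtain d \<sigma>0 \<sigma> \<sigma>x \<tau>R \<tau>I where *: "multipliers d \<sigma>0 \<sigma> \<sigma>x \<tau>R \<tau>I" "f = combination \<sigma>0 \<sigma> \<sigma>x \<tau>R \<tau>I"
    unfolding M_def by (auto elim: certifiedE)
  have "(\<Sum>k\<in>{1..m}. \<tau>R k z * hR k z) = 0" "(\<Sum>k\<in>{1..m}. \<tau>I k z * Ik n m k z) = 0"
    using z by (auto simp: K_def)
  moreover have "(\<Sum>j\<in>{1..n}. \<sigma> j z * (1 - (z (j - 1))\<^sup>2)) \<ge> 0"
    using z *(1) by (intro sum_nonneg mult_nonneg_nonneg) (auto simp: K_def multipliers_def intro: sos_nonneg)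
  moreover have "(\<Sum>k\<in>{1..m-1}. \<sigma>x k z * (z (n + m - 1) - z (n + k - 1))) \<ge> 0"
    using z *(1) by (intro sum_nonneg mult_nonneg_nonneg) (auto simp: K_def multipliers_def intro: sos_nonneg)
  moreover have "\<sigma>0 z \<ge> 0" using *(1) by (auto simp: multipliers_def intro: sos_nonneg)
  ultimately show ?thesis unfolding *(2) combination_def by linarith
qed

lemma esym_0: "esym n m 0 z = 1"
proof -
  have "{S. S \<subseteq> {1..m} \<and> card S = 0} = {{}}" by (auto simp: finite_subset)
  then show ?thesis by (simp add: esym_def)
qed

text \<open>Valid at every \<open>z\<close>, this measures the failure of Vieta's relations by the
  equality constraints. The error vanishes on \<open>K\<close> and is otherwise a combination of
  constraint polynomials, which is what \<open>bounded_svar\<close> uses.\<close>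

lemma char_poly_svar:
  "(\<Sum>k\<le>m. complex_of_real (p k z) * X ^ k) = (\<Prod>l\<in>{1..m}. X - svar n m z l) +
     (\<Sum>k\<in>{1..m}. (-1) ^ k * Complex (hR k z) (- Ik n m k z) * X ^ (m - k))"
proof -
  have h: "Complex (hR k z) (- Ik n m k z) = (-1) ^ k * complex_of_real (p (m - k) z) - esym n m k z" for k
  proof -
    have "((-1) ^ k :: complex) = of_real ((-1) ^ k)" by simp
    then show ?thesis by (simp only: complex_eq_iff) (simp add: hR_def Rk_def Ik_def)
  qed
  have "(\<Sum>k\<le>m. complex_of_real (p k z) * X ^ k) = (\<Sum>k\<le>m. complex_of_real (p (m - k) z) * X ^ (m - k))"
    by (rule sum.reindex_bij_witness[of _ "\<lambda>k. m - k" "\<lambda>k. m - k"]) auto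
  also have "\<dots> = (\<Sum>k\<le>m. (-1) ^ k * esym n m k z * X ^ (m - k)) +
      (\<Sum>k\<le>m. (-1) ^ k * Complex (hR k z) (- Ik n m k z) * X ^ (m - k))"
    unfolding h by (simp add: algebra_simps flip: sum.distrib power_add mult_2 add: power_mult)
  also have "(\<Sum>k\<le>m. (-1) ^ k * Complex (hR k z) (- Ik n m k z) * X ^ (m - k)) =
     (\<Sum>k\<in>{1..m}. (-1) ^ k * Complex (hR k z) (- Ik n m k z) * X ^ (m - k))"
    \<comment> \<open>The term \<open>k = 0\<close> drops out because \<open>p m\<close> and the
      zeroth elementary symmetric polynomial are both 1.\<close>
    by (rule sum.mono_neutral_right) (auto simp: h esym_0 monic not_le)
  also have "(\<Sum>k\<le>m. (-1) ^ k * esym n m k z * X ^ (m - k)) = (\<Prod>l\<in>{1..m}. X - svar n m z l)"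
    unfolding esym_def by (rule vieta[symmetric])
  finally show ?thesis .
qed

lemma abscissa_on_K:
  assumes z: "z \<in> K"
  shows "abscissa m p z = z (n + m - 1)"
proof -
  have "(\<Sum>k\<in>{1..m}. (-1) ^ k * Complex (hR k z) (- Ik n m k z) * X ^ (m - k)) = 0" for X
    using z by (intro sum.neutral) (auto simp: K_def Complex_eq_0)
  then have eq: "(\<Sum>k\<le>m. complex_of_real (p k z) * X ^ k) = (\<Prod>l\<in>{1..m}. X - svar n m z l)" for X
    using char_poly_svar[of z X] by simp
  have "{Re s |s. (\<Sum>k\<le>m. complex_of_real (p k z) * s ^ k) = 0} = Re ` svar n m z ` {1..m}"
    unfolding eq by auto
  also have "\<dots> = (\<lambda>l. z (n + l - 1)) ` {1..m}" by (simp add: image_image svar_def)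
  finally have "{Re s |s. (\<Sum>k\<le>m. complex_of_real (p k z) * s ^ k) = 0} = (\<lambda>l. z (n + l - 1)) ` {1..m}" .
  moreover have "z (n + l - 1) \<le> z (n + m - 1)" if "l \<in> {1..m}" for l
    using z that by (cases "l = m") (auto simp: K_def)
  ultimately show ?thesis unfolding abscissa_def using m by (auto intro!: Max_eqI)
qed

text \<open>The point \<open>z\<close> lists a root arrangement of the polynomial at
  \<open>q\<close>. The filler \<open>c\<close> for the coordinates from \<open>N\<close> on is left
  open, so that a lift into the compact slice \<open>K0\<close> can be chosen.\<close>

lemma K_surjective:
  assumes q: "\<And>j. j < n \<Longrightarrow> (q j)\<^sup>2 \<le> 1"
  obtains z where "z \<in> K" "\<And>i. i < n \<Longrightarrow> z i = q i" "\<And>i. i \<ge> N \<Longrightarrow> z i = c"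
proof -
  obtain s yt where s: "\<And>X. (\<Sum>k\<le>m. complex_of_real (p k q) * X ^ k) = (\<Prod>l\<in>{1..m}. X - s l)"
    "\<And>l. l \<in> {1..m} \<Longrightarrow> Re (s l) \<le> Re (s m)" "\<And>l. l \<in> {1..m} \<Longrightarrow> Im (s l) = yfull m yt l"
    using root_arrangement[of m "\<lambda>k. p k q"] m by (auto simp: monic)
  define z where "z i = (if i < n then q i else if i < n + m then Re (s (i - n + 1)) else if i < N then yt (i - (n + m)) else c)" for i
  have yz: "yfull m (\<lambda>j. z (n + m + j)) l = yfull m yt l" if l: "l \<in> {1..m}" for l
  proof -
    define z' where "z' i = yt (i - (n + m))" for i
    have eq: "z (n + m + j) = z' (n + m + j)" if "j < nfree m" for j
      using that by (simp add: z_def z'_def)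
    have "yfull m (\<lambda>j. z (n + m + j)) l = yfull m (\<lambda>j. (\<lambda>i. z (n + m + i)) (0 + j)) l" by simp
    also have "\<dots> = yfull m (\<lambda>j. (\<lambda>i. z' (n + m + i)) (0 + j)) l"
      using yfull_polys[OF l, of 0 "nfree m"] by (rule polys_cong) (auto simp: eq)
    finally show ?thesis by (simp add: z'_def)
  qed
  have sv: "svar n m z l = s l" if l: "l \<in> {1..m}" for l
    using l s(3)[OF l] yz[OF l] by (auto simp: svar_def complex_eq_iff z_def)
  have pz: "p k z = p k q" if "k \<le> m" for k
    using that p_polys[of k] polys_cong[of "p k" n z q] by (cases "k = m") (auto simp: monic z_def)
  \<comment> \<open>Both polynomials in \<open>X\<close> equal the same product, so the error term
    vanishes identically. Padded with a zero coefficient at degree \<open>m\<close>, it has the form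
    to which \<open>polyfun_eq_0\<close> applies, and each constraint vanishes.\<close>
  have "(\<Sum>k\<in>{1..m}. (-1) ^ k * Complex (hR k z) (- Ik n m k z) * X ^ (m - k)) = 0" for X
    using char_poly_svar[of z X] s(1)[of X] by (simp add: pz sv)
  then have "(\<Sum>i\<le>m. (if i < m then (-1) ^ (m - i) * Complex (hR (m - i) z) (- Ik n m (m - i) z) else 0) * X ^ i) = 0" for X
  proof -
    assume *: "\<And>X. (\<Sum>k\<in>{1..m}. (-1) ^ k * Complex (hR k z) (- Ik n m k z) * X ^ (m - k)) = 0"
    have "(\<Sum>i\<le>m. (if i < m then (-1) ^ (m - i) * Complex (hR (m - i) z) (- Ik n m (m - i) z) else 0) * X ^ i) =
      (\<Sum>i<m. (-1) ^ (m - i) * Complex (hR (m - i) z) (- Ik n m (m - i) z) * X ^ i)"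
      by (intro sum.mono_neutral_cong_right) auto
    also have "\<dots> = (\<Sum>k\<in>{1..m}. (-1) ^ k * Complex (hR k z) (- Ik n m k z) * X ^ (m - k))"
      by (rule sum.reindex_bij_witness[of _ "\<lambda>k. m - k" "\<lambda>k. m - k"]) auto
    finally show ?thesis using * by simp
  qed
  then have co: "\<forall>i\<le>m. (if i < m then (-1) ^ (m - i) * Complex (hR (m - i) z) (- Ik n m (m - i) z) else 0) = 0"
    by (simp only: polyfun_eq_0[symmetric]) simp
  have zero: "hR k z = 0 \<and> Ik n m k z = 0" if "k \<in> {1..m}" for k
  proof -
    have "m - (m - k) = k" using that by auto
    then show ?thesis using co[rule_format, of "m - k"] that by (auto simp: Complex_eq_0)
  qed
  have "z (n + k - 1) \<le> z (n + m - 1)" if "k \<in> {1..m-1}" for k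
    using s(2)[of k] that m by (auto simp: z_def)
  then have "z \<in> K" using q zero unfolding K_def by (auto simp: z_def)
  then show ?thesis using that by (auto simp: z_def)
qed

section \<open>The Archimedean property\<close>

lemma bounded_q: "j < n \<Longrightarrow> bounded_elt M (\<lambda>z. z j)"
  by (rule bounded_eltI_square[OF M_qm _ M_q]) (auto intro: polys_coordinate)

lemma bounded_polys_n: "f \<in> polys n \<Longrightarrow> bounded_elt M f"
  by (induction rule: polys_induct)
     (auto intro: bounded_elt_const[OF M_qm] bounded_elt_add[OF M_qm] bounded_elt_mult[OF M_qm] bounded_q)

text \<open>Modulo the equality constraints, \<open>s^m = - V\<close> with \<open>V\<close> the sum
  of the lower terms \<open>p k * s^k\<close>. For \<open>t = |s|^2\<close> this gives
  \<open>t^m = |V|^2\<close> modulo constraints, and Cauchy--Schwarz with bounds on the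
  \<open>p k\<close> yields the inequality required by \<open>qm_root_bound\<close>.\<close>

lemma bounded_svar:
  assumes l: "l \<in> {1..m}"
  shows "\<exists>c. (\<lambda>z. c - (cmod (svar n m z l))\<^sup>2) \<in> M"
proof -
  define s where "s z = svar n m z l" for z
  have s: "s \<in> complex_closure" unfolding s_def[abs_def] using svar_closure[OF l] .
  define t where "t z = (cmod (s z))\<^sup>2" for z
  have t: "t \<in> SOS" unfolding t_def[abs_def] by (rule SOS_cmod_square[OF s])
  define v where "v k z = complex_of_real (p k z) * s z ^ k" for k z
  have v: "v k \<in> complex_closure" if "k < m" for k
    unfolding v_def[abs_def] using that by (intro complex_closure_intros p_N s) auto
  define V where "V z = (\<Sum>k<m. v k z)" for z
  have V: "V \<in> complex_closure" unfolding V_def[abs_def] using v by (intro complex_closure_intros) auto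
  \<comment> \<open>Elements in \<open>M\<close> with their negatives form an ideal containing the
    equality constraints; membership in it is computation modulo these constraints.\<close>
  define I where "I = {f \<in> polys N. f \<in> M \<and> (\<lambda>z. - f z) \<in> M}"
  have I_mult: "(\<lambda>z. g z * f z) \<in> I" if "f \<in> I" "g \<in> polys N" for f g
    using qm_ideal[OF M_qm _ _ that(2), of f] qm_ideal[OF M_qm _ _ that(2), of "\<lambda>z. - f z"] that
    by (auto simp: I_def intro: closed)
  have I_add: "(\<lambda>z. f z + g z) \<in> I" if "f \<in> I" "g \<in> I" for f g
    using qm_add[OF M_qm, of f g] qm_add[OF M_qm, of "\<lambda>z. - f z" "\<lambda>z. - g z"] that
    by (auto simp: I_def intro: closed)
  have I_zero: "(\<lambda>_. 0) \<in> I" using qm_const[OF M_qm, of 0] by (auto simp: I_def const)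
  have I_sum: "(\<lambda>z. \<Sum>i\<in>J. f i z) \<in> I" if "\<And>i. i \<in> J \<Longrightarrow> f i \<in> I" for f and J :: "nat set"
    using that I_zero by (induction J rule: infinite_finite_induct) (auto simp: I_add)
  have I_hR: "hR k \<in> I" and I_Ik: "Ik n m k \<in> I" if "k \<in> {1..m}" for k
    using M_hR[OF that, of 1] M_hR[OF that, of "-1"] M_Ik[OF that, of 1] M_Ik[OF that, of "-1"]
    by (auto simp: I_def hR_polys Ik_polys)
  define J where "J z = (\<Sum>k\<in>{1..m}. Complex (hR k z) (- Ik n m k z) * ((-1) ^ k * s z ^ (m - k)))" for z
  have JV: "s z ^ m = J z - V z" for z
  proof -
    have "(\<Prod>j\<in>{1..m}. s z - svar n m z j) = 0" using l by (auto simp: s_def)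
    then have "(\<Sum>k\<le>m. complex_of_real (p k z) * s z ^ k) = J z"
      using char_poly_svar[of z "s z"] by (simp add: J_def algebra_simps)
    moreover have "(\<Sum>k\<le>m. complex_of_real (p k z) * s z ^ k) = V z + s z ^ m"
      by (simp add: V_def v_def lessThan_Suc_atMost[symmetric] monic)
    ultimately show ?thesis by (simp add: algebra_simps)
  qed
  have G: "(\<lambda>z. (-1) ^ k * s z ^ (m - k)) \<in> complex_closure" for k
    using complex_closure_mult[OF complex_closure_of_real[OF const[of "(-1) ^ k"]] complex_closure_power[OF s, of "m - k"]] by simp
  have JI: "(\<lambda>z. Re (J z)) \<in> I" "(\<lambda>z. Im (J z)) \<in> I"
  proof -
    have GR: "(\<lambda>z. Re ((-1) ^ k * s z ^ (m - k))) \<in> polys N" "(\<lambda>z. Im ((-1) ^ k * s z ^ (m - k))) \<in> polys N" for k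
      using G[of k] by (auto simp: complex_closure_def)
    have "(\<lambda>z. \<Sum>k\<in>{1..m}. Re ((-1) ^ k * s z ^ (m - k)) * hR k z + Im ((-1) ^ k * s z ^ (m - k)) * Ik n m k z) \<in> I"
      by (intro I_sum I_add I_mult GR I_hR I_Ik)
    then show "(\<lambda>z. Re (J z)) \<in> I" by (rule qm_cong) (simp add: J_def algebra_simps)
    have "(\<lambda>z. \<Sum>k\<in>{1..m}. Im ((-1) ^ k * s z ^ (m - k)) * hR k z + (- Re ((-1) ^ k * s z ^ (m - k))) * Ik n m k z) \<in> I"
      by (intro I_sum I_add I_mult GR I_hR I_Ik minus)
    then show "(\<lambda>z. Im (J z)) \<in> I" by (rule qm_cong) (simp add: J_def algebra_simps)
  qed
  have VR: "(\<lambda>z. Re (V z)) \<in> polys N" "(\<lambda>z. Im (V z)) \<in> polys N" using V by (auto simp: complex_closure_def)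
  have JR: "(\<lambda>z. Re (J z)) \<in> polys N" "(\<lambda>z. Im (J z)) \<in> polys N" using JI by (auto simp: I_def)
  \<comment> \<open>By \<open>JV\<close>, this expression is
    \<open>|V|^2 - |J - V|^2 = |V|^2 - t^m\<close>, written with factors from the ideal.\<close>
  have "(\<lambda>z. (2 * Re (V z) - Re (J z)) * Re (J z) + (2 * Im (V z) - Im (J z)) * Im (J z)) \<in> I"
    by (intro I_add I_mult JI closed VR JR)
  then have "(\<lambda>z. (2 * Re (V z) - Re (J z)) * Re (J z) + (2 * Im (V z) - Im (J z)) * Im (J z)) \<in> M"
    by (simp add: I_def)
  then have 1: "(\<lambda>z. (cmod (V z))\<^sup>2 - t z ^ m) \<in> M"
  proof (rule qm_cong)
    fix z
    have "t z ^ m = (cmod (s z ^ m))\<^sup>2" by (simp add: t_def norm_power mult.commute flip: power_mult)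
    also have "\<dots> = (Re (J z) - Re (V z))\<^sup>2 + (Im (J z) - Im (V z))\<^sup>2" unfolding JV cmod_power2 by simp
    finally show "(2 * Re (V z) - Re (J z)) * Re (J z) + (2 * Im (V z) - Im (J z)) * Im (J z) = (cmod (V z))\<^sup>2 - t z ^ m"
      unfolding cmod_power2 by (simp add: power2_eq_square algebra_simps)
  qed
  have vt: "(cmod (v k z))\<^sup>2 = t z ^ k * (p k z)\<^sup>2" for k z
    by (simp add: v_def t_def norm_mult norm_power power_mult_distrib mult.commute flip: power_mult)
  have 2: "(\<lambda>z. real m * (\<Sum>k<m. t z ^ k * (p k z)\<^sup>2) - (cmod (V z))\<^sup>2) \<in> M"
    unfolding vt[symmetric] V_def by (rule qm_cauchy_schwarz[OF M_qm v])
  have "\<forall>k. \<exists>c. k < m \<longrightarrow> (\<lambda>z. c - (p k z)\<^sup>2) \<in> M"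
    using bounded_elt_square[OF M_qm bounded_polys_n[OF p_polys]] by (auto simp: bounded_elt_def)
  then obtain c where c: "\<And>k. k < m \<Longrightarrow> (\<lambda>z. c k - (p k z)\<^sup>2) \<in> M" by metis
  \<comment> \<open>The absolute values give one nonnegative constant above every
    \<open>c k\<close>.\<close>
  define C where "C = (\<Sum>k<m. \<bar>c k\<bar>)"
  have C: "C \<ge> 0" "\<And>k. k < m \<Longrightarrow> c k \<le> C" unfolding C_def
    by (auto intro!: sum_nonneg order_trans[OF abs_ge_self member_le_sum[of _ _ "\<lambda>k. \<bar>c k\<bar>"]])
  have tp: "(\<lambda>z. t z ^ k * f z) \<in> M" if "f \<in> M" for f k
    using that by (induction k) (auto simp: mult.assoc intro: qm_SOS_mult[OF M_qm t])
  have 3: "(\<lambda>z. real m * (\<Sum>k<m. t z ^ k * ((c k - (p k z)\<^sup>2) + (C - c k)))) \<in> M"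
    by (intro qm_scale[OF M_qm] qm_sum[OF M_qm] tp qm_add[OF M_qm] c qm_const[OF M_qm]) (auto simp: C)
  have "(\<lambda>z. real m * C * (\<Sum>k<m. t z ^ k) - t z ^ m) \<in> M"
    using qm_add[OF M_qm qm_add[OF M_qm 1 2] 3]
    by (rule qm_cong) (simp add: sum_distrib_left sum_distrib_right algebra_simps sum_subtractf)
  then have "\<exists>c. (\<lambda>z. c - t z) \<in> M" by (intro qm_root_bound[OF M_qm t m, of "real m * C"]) (simp_all add: C)
  then show ?thesis by (simp add: t_def s_def)
qed

text \<open>From \<open>c - |s|^2\<close> in \<open>M\<close>, adding the square of one part of
  \<open>s\<close> leaves the bound for the other part.\<close>

lemma coordinate_bound: "i < N \<Longrightarrow> \<exists>c. (\<lambda>z. c - (z i)\<^sup>2) \<in> M"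
proof -
  assume i: "i < N"
  have Re: "\<exists>c. (\<lambda>z. c - (Re (svar n m z l))\<^sup>2) \<in> M" and Im: "\<exists>c. (\<lambda>z. c - (Im (svar n m z l))\<^sup>2) \<in> M" if l: "l \<in> {1..m}" for l
  proof -
    obtain c where c: "(\<lambda>z. c - (cmod (svar n m z l))\<^sup>2) \<in> M" using bounded_svar[OF l] by blast
    have "(\<lambda>z. Re (svar n m z l)) \<in> polys N" "(\<lambda>z. Im (svar n m z l)) \<in> polys N"
      using svar_closure[OF l] by (auto simp: complex_closure_def)
    then have *: "(\<lambda>z. (Re (svar n m z l))\<^sup>2) \<in> M" "(\<lambda>z. (Im (svar n m z l))\<^sup>2) \<in> M" by (auto intro: qm_square[OF M_qm])
    show "\<exists>c. (\<lambda>z. c - (Re (svar n m z l))\<^sup>2) \<in> M" "\<exists>c. (\<lambda>z. c - (Im (svar n m z l))\<^sup>2) \<in> M"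
      using qm_add[OF M_qm c *(2)] qm_add[OF M_qm c *(1)] by (auto simp: cmod_power2 intro!: exI[of _ c])
  qed
  consider "i < n" | "n \<le> i" "i < n + m" | "n + m \<le> i" by linarith
  then show ?thesis
  proof cases
    case 1
    then show ?thesis using M_q by blast
  next
    case 2
    then show ?thesis using Re[of "i - n + 1"] by (auto simp: svar_def)
  next
    case 3
    then have "i - (n + m) < nfree m" using i by auto
    then obtain l where "l \<in> {1..m}" "\<forall>yt. yfull m yt l = yt (i - (n + m))"
      by (rule free_variable_yfull)
    then show ?thesis using Im[of l] 3 by (auto simp: svar_def)
  qed
qed

lemma M_archimedean: "archimedean M"
proof -
  have "bounded_elt M f" if "f \<in> polys N" for f
    using that
  proof (induction rule: polys_induct)
    case (coordinate i)
    then show ?case using coordinate_bound[of i] by (auto intro: bounded_eltI_square[OF M_qm] polys_coordinate)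
  qed (auto intro: bounded_elt_const[OF M_qm] bounded_elt_add[OF M_qm] bounded_elt_mult[OF M_qm])
  then show ?thesis unfolding archimedean_def bounded_elt_def by blast
qed

text \<open>A character nonnegative on \<open>M\<close> is evaluation at a point satisfying all
  constraints, that is, at a point of \<open>K\<close>. For the equalities, both signs of the
  constraint are tested.\<close>

theorem positive_on_K_imp_M:
  assumes f: "f \<in> polys N" and pos: "\<And>z. z \<in> K \<Longrightarrow> f z > 0"
  shows "f \<in> M"
proof (rule putinar_abstract[OF M_qm M_archimedean f])
  fix \<phi> assume phi: "character \<phi>" "\<And>a. a \<in> polys N \<Longrightarrow> a \<in> M \<Longrightarrow> \<phi> a \<ge> 0"
  define z where "z i = \<phi> (\<lambda>z. z i)" for i
  have ev: "\<phi> g = g z" if "g \<in> polys N" for g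
    unfolding z_def by (rule character_polys[OF phi(1) that])
  have nonneg: "g z \<ge> 0" if "g \<in> polys N" "g \<in> M" for g using ev[OF that(1)] phi(2)[OF that] by simp
  have "(z j)\<^sup>2 \<le> 1" if "j < n" for j
  proof -
    have "(\<lambda>z. 1 - (z j)\<^sup>2) \<in> polys N" using that by (intro closed polys_coordinate) auto
    from nonneg[OF this M_q[OF that]] show ?thesis by simp
  qed
  moreover have "z (n + k - 1) \<le> z (n + m - 1)" if "k \<in> {1..m-1}" for k
  proof -
    have "(\<lambda>z. z (n + m - 1) - z (n + k - 1)) \<in> polys N" using that by (intro closed polys_coordinate) auto
    from nonneg[OF this M_x[OF that]] show ?thesis by simp
  qed
  moreover have "hR k z = 0" if "k \<in> {1..m}" for k
    using nonneg[OF scale[OF hR_polys] M_hR[OF that], of 1] nonneg[OF scale[OF hR_polys] M_hR[OF that], of "-1"] by simp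
  moreover have "Ik n m k z = 0" if "k \<in> {1..m}" for k
    using nonneg[OF scale[OF Ik_polys] M_Ik[OF that], of 1] nonneg[OF scale[OF Ik_polys] M_Ik[OF that], of "-1"] by simp
  ultimately have "z \<in> K" by (auto simp: K_def)
  then show "\<phi> f > 0" using pos ev[OF f] by simp
qed

end

section \<open>Convergence\<close>

lemma compact_Pi_UNIV:
  fixes S :: "'i \<Rightarrow> 'b::topological_space set"
  assumes "\<And>i. compact (S i)"
  shows "compact (Pi UNIV S)"
  using compactin_PiE[of "\<lambda>_. euclidean" UNIV S] assms
  by (simp add: euclidean_product_topology compactin_euclidean_iff PiE_UNIV_domain)

text \<open>Points of the box are \<open>undefined\<close> from \<open>n\<close> on, so in the space
  of all sequences it is a product with singleton factors, compact by Tychonoff's theorem.\<close>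

lemma Qbox_eq_Pi: "Qbox n = Pi UNIV (\<lambda>i. if i < n then {-1..1} else {undefined})"
  by (fastforce simp: Qbox_def PiE_iff extensional_def Pi_iff split: if_splits)

lemma compact_Qbox: "compact (Qbox n)"
  unfolding Qbox_eq_Pi by (rule compact_Pi_UNIV) auto

lemma Qbox_square_le: "q \<in> Qbox n \<Longrightarrow> j < n \<Longrightarrow> (q j)\<^sup>2 \<le> 1"
  by (auto simp: Qbox_def PiE_iff power2_le_iff_abs_le abs_le_iff square_le_1)

lemma sets_Qbox: "Qbox n \<in> sets (Leb n)"
  unfolding Qbox_def Leb_def by (intro sets_PiM_I_finite) auto

lemma emeasure_Qbox_finite: "emeasure (Leb n) (Qbox n) < \<infinity>"
proof -
  interpret product_sigma_finite "\<lambda>_::nat. lborel :: real measure" ..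
  have "emeasure (Leb n) (Qbox n) = (\<Prod>i<n. emeasure lborel {-1..1::real})"
    unfolding Leb_def Qbox_def by (rule emeasure_PiM) auto
  also have "\<dots> \<noteq> top" by (simp add: ennreal_prod_eq_top del: prod_constant)
  finally show ?thesis by (simp add: less_top)
qed

lemma polys_dense:
  assumes "continuous_on (Qbox n) f" "e > 0"
  obtains g where "g \<in> polys n" "\<And>q. q \<in> Qbox n \<Longrightarrow> \<bar>f q - g q\<bar> < e"
proof -
  interpret A: function_algebra "polys n" by (rule polys_algebra)
  interpret function_ring_on "polys n" "Qbox n"
  proof
    fix x y :: "nat \<Rightarrow> real" assume *: "x \<in> Qbox n" "y \<in> Qbox n" "x \<noteq> y"
    then obtain i where "x i \<noteq> y i" by auto
    then have "i < n" using * by (auto simp: Qbox_def PiE_iff extensional_def)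
    then show "\<exists>f\<in>polys n. f x \<noteq> f y" using \<open>x i \<noteq> y i\<close> by (intro bexI[of _ "\<lambda>z. z i"] polys_coordinate)
  qed (auto intro: compact_Qbox polys_continuous A.closed)
  show ?thesis using Stone_Weierstrass_basic[OF assms] that by blast
qed

text \<open>\<open>Leb n\<close> carries the product sigma-algebra over the first \<open>n\<close>
  coordinates, where polynomials are measurable. A continuous function is reached as a pointwise
  limit of polynomials on the box.\<close>

lemma continuous_on_Qbox_measurable:
  fixes f :: "(nat \<Rightarrow> real) \<Rightarrow> real"
  assumes f: "continuous_on (Qbox n) f"
  shows "(\<lambda>q. indicator (Qbox n) q * f q) \<in> borel_measurable (Leb n)"
proof -
  have "\<exists>g\<in>polys n. \<forall>q\<in>Qbox n. \<bar>f q - g q\<bar> < inverse (real (Suc i))" for i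
    using polys_dense[OF f, of "inverse (real (Suc i))"] by (metis inverse_Suc)
  then obtain g where g: "\<And>i. g i \<in> polys n" "\<And>i q. q \<in> Qbox n \<Longrightarrow> \<bar>f q - g i q\<bar> < inverse (real (Suc i))" by metis
  show ?thesis
  proof (rule borel_measurable_LIMSEQ_real)
    show "(\<lambda>q. indicator (Qbox n) q * g i q) \<in> borel_measurable (Leb n)" for i
      using sets_Qbox polys_measurable[OF g(1)] by (intro borel_measurable_times borel_measurable_indicator)
    fix q
    have "(\<lambda>i. g i q) \<longlonglongrightarrow> f q" if "q \<in> Qbox n"
    proof -
      have "norm (g i q - f q) \<le> inverse (real (Suc i))" for i using g(2)[OF that, of i] by simp
      then have "(\<lambda>i. g i q - f q) \<longlonglongrightarrow> 0"
        by (intro Lim_null_comparison[OF _ LIMSEQ_inverse_real_of_nat] always_eventually) auto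
      then show ?thesis by (rule LIM_zero_cancel)
    qed
    then show "(\<lambda>i. indicator (Qbox n) q * g i q) \<longlonglongrightarrow> indicator (Qbox n) q * f q"
      by (cases "q \<in> Qbox n") auto
  qed
qed

lemma continuous_on_Qbox_integrable:
  fixes f :: "(nat \<Rightarrow> real) \<Rightarrow> real"
  assumes f: "continuous_on (Qbox n) f"
  shows "set_integrable (Leb n) (Qbox n) f"
proof -
  obtain B where B: "\<And>q. q \<in> Qbox n \<Longrightarrow> norm (f q) \<le> B"
    using compact_imp_bounded[OF compact_continuous_image[OF f compact_Qbox]] by (auto simp: bounded_iff)
  have "integrable (Leb n) (\<lambda>q. indicator (Qbox n) q *\<^sub>R (indicator (Qbox n) q * f q))"
    by (rule integrableI_bounded_set_indicator[OF sets_Qbox continuous_on_Qbox_measurable[OF f], of B])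
       (use B emeasure_Qbox_finite in auto)
  moreover have "indicator (Qbox n) q *\<^sub>R (indicator (Qbox n) q * f q) = indicator (Qbox n) q *\<^sub>R f q" for q
    by (simp add: indicator_def)
  ultimately show ?thesis unfolding set_integrable_def by (simp only:)
qed

section \<open>Continuity of the abscissa and bounds on the optimal value\<close>

context abscissa_program
begin

abbreviation a :: "(nat \<Rightarrow> real) \<Rightarrow> real" where "a \<equiv> abscissa m p"

lemma abscissa_cong: "(\<And>i. i < n \<Longrightarrow> q i = q' i) \<Longrightarrow> a q = a q'"
proof -
  assume q: "\<And>i. i < n \<Longrightarrow> q i = q' i"
  have "p k q = p k q'" if "k \<le> m" for k
    using that p_polys[of k] polys_cong[of "p k" n q q'] q by (cases "k = m") (auto simp: monic)
  then show ?thesis unfolding abscissa_def by simp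
qed

lemma restrict_K_in_Qbox: "z \<in> K \<Longrightarrow> restrict z {..<n} \<in> Qbox n"
  by (auto simp: K_def Qbox_def abs_square_le_1 abs_le_iff)

text \<open>\<open>K\<close> leaves the coordinates from \<open>N\<close> on free and so is not
  compact; this slice fixes them.\<close>

definition K0 :: "(nat \<Rightarrow> real) set" where
  "K0 = {z \<in> K. \<forall>i\<ge>N. z i = undefined}"

lemma compact_K0: "compact K0"
proof -
  have "\<forall>i. \<exists>c. i < N \<longrightarrow> (\<lambda>z. c - (z i)\<^sup>2) \<in> M" using coordinate_bound by blast
  then obtain c where c: "\<And>i. i < N \<Longrightarrow> (\<lambda>z. c i - (z i)\<^sup>2) \<in> M" by metis
  \<comment> \<open>The Archimedean certificates, evaluated on \<open>K\<close>, bound each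
    coordinate.\<close>
  have b: "\<bar>z i\<bar> \<le> sqrt (c i)" if "z \<in> K" "i < N" for z i
    using M_nonneg[OF c[OF that(2)] that(1)] real_le_rsqrt[of "\<bar>z i\<bar>" "c i"] by simp
  let ?B = "Pi UNIV (\<lambda>i. if i < N then {- sqrt (c i)..sqrt (c i)} else {undefined})"
  have cont: "continuous_on UNIV (\<lambda>z. z i)" for i :: nat
    by (rule continuous_on_product_coordinates)
  have "K = (\<Inter>j\<in>{..<n}. {z. (z j)\<^sup>2 \<le> 1}) \<inter> (\<Inter>k\<in>{1..m-1}. {z. z (n + k - 1) \<le> z (n + m - 1)}) \<inter>
      (\<Inter>k\<in>{1..m}. {z. hR k z = 0} \<inter> {z. Ik n m k z = 0})"
    by (auto simp: K_def)
  moreover have "closed \<dots>"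
    by (intro closed_Int closed_INT ballI closed_Collect_le closed_Collect_eq continuous_intros cont
        polys_continuous[OF hR_polys] polys_continuous[OF Ik_polys])
  ultimately have "closed K" by simp
  have "compact ?B" by (rule compact_Pi_UNIV) auto
  then have "compact (?B \<inter> K)" using \<open>closed K\<close> by (rule compact_Int_closed)
  also have "?B \<inter> K = K0"
  proof (intro equalityI subsetI)
    fix z assume z: "z \<in> ?B \<inter> K"
    then have "z i \<in> (if i < N then {- sqrt (c i)..sqrt (c i)} else {undefined})" for i by blast
    then have "z i = undefined" if "i \<ge> N" for i using that by (metis not_le singletonD)
    then show "z \<in> K0" using z by (simp add: K0_def)
  next
    fix z assume z: "z \<in> K0"
    then have "z i \<in> (if i < N then {- sqrt (c i)..sqrt (c i)} else {undefined})" for i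
      using b[of z i] by (simp add: K0_def abs_le_iff minus_le_iff)
    then show "z \<in> ?B \<inter> K" using z by (simp add: K0_def)
  qed
  finally show ?thesis .
qed

text \<open>The abscissa is the coordinate \<open>x\<^sub>m\<close> on a compact set that projects onto the box,
  so its closed preimages are images of compact sets.\<close>

lemma abscissa_continuous: "continuous_on (Qbox n) a"
  unfolding continuous_on_closed_invariant
proof (intro allI impI)
  fix B :: "real set" assume "closed B"
  let ?p = "\<lambda>z. restrict z {..<n}"
  let ?C = "K0 \<inter> (\<lambda>z. z (n + m - 1)) -` B"
  have "continuous_on UNIV (\<lambda>z::nat \<Rightarrow> real. z (n + m - 1))" by (rule continuous_on_product_coordinates)
  then have "closed ((\<lambda>z::nat \<Rightarrow> real. z (n + m - 1)) -` B)" by (rule closed_vimage[OF \<open>closed B\<close>])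
  then have "compact ?C" by (rule compact_Int_closed[OF compact_K0])
  moreover have "continuous_on ?C ?p"
  proof (rule continuous_on_coordinatewise_then_product)
    fix i show "continuous_on ?C (\<lambda>z. ?p z i)"
      by (cases "i < n") (auto intro: continuous_on_subset[OF continuous_on_product_coordinates])
  qed
  ultimately have "closed (?p ` ?C)" using compact_continuous_image compact_imp_closed by blast
  moreover have "?p ` ?C \<inter> Qbox n = a -` B \<inter> Qbox n"
  proof (intro equalityI subsetI)
    fix q assume "q \<in> ?p ` ?C \<inter> Qbox n"
    then obtain z where z: "z \<in> K" "z (n + m - 1) \<in> B" "q = ?p z" "q \<in> Qbox n" by (auto simp: K0_def)
    have "a q = a z" using z(3) by (intro abscissa_cong) auto
    then show "q \<in> a -` B \<inter> Qbox n" using z abscissa_on_K[OF z(1)] by auto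
  next
    fix q assume q: "q \<in> a -` B \<inter> Qbox n"
    then obtain z where z: "z \<in> K" "\<And>i. i < n \<Longrightarrow> z i = q i" "\<And>i. i \<ge> N \<Longrightarrow> z i = undefined"
      using K_surjective[of q undefined] Qbox_square_le[of q n] by blast
    have "?p z = q" using z(2) q by (auto simp: Qbox_def PiE_iff extensional_def fun_eq_iff)
    moreover have "z (n + m - 1) \<in> B" using abscissa_on_K[OF z(1)] abscissa_cong[of z q] z(2) q by auto
    ultimately show "q \<in> ?p ` ?C \<inter> Qbox n" using z q by (auto simp: K0_def)
  qed
  ultimately show "\<exists>A. closed A \<and> A \<inter> Qbox n = a -` B \<inter> Qbox n" by blast
qed

lemma feasible_le_abscissa:
  assumes w: "feasible n m p d w" and q: "q \<in> Qbox n"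
  shows "w q \<le> a q"
proof -
  obtain z where z: "z \<in> K" "\<And>i. i < n \<Longrightarrow> z i = q i" "\<And>i. i \<ge> N \<Longrightarrow> z i = undefined"
    using K_surjective[of q undefined] Qbox_square_le[of q n] q by blast
  have "w \<in> polys n" using w by (auto simp: feasible_def polys_def)
  then have "w z = w q" using z(2) by (rule polys_cong)
  moreover have "(\<lambda>z. z (n + m - 1) - w z) \<in> M" using w by (auto simp: feasible_iff_certified M_def)
  then have "w z \<le> z (n + m - 1)" using M_nonneg[OF _ z(1)] by fastforce
  moreover have "z (n + m - 1) = a q" using abscissa_on_K[OF z(1)] abscissa_cong[of z q] z(2) by auto
  ultimately show ?thesis by simp
qed

text \<open>On \<open>K\<close> the coordinate for \<open>x_m\<close> is the abscissa of the box
  point below, so the strict inequality is positivity on \<open>K\<close>. The certificate obtained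
  persists at all higher levels.\<close>

lemma below_abscissa_feasible:
  assumes w: "w \<in> polys n" and less: "\<And>q. q \<in> Qbox n \<Longrightarrow> w q < a q"
  obtains d1 where "\<And>d. d \<ge> d1 \<Longrightarrow> feasible n m p d w"
proof -
  obtain k where k: "poly_fun n k w" using w by (auto simp: polys_def)
  have "(\<lambda>z. z (n + m - 1) - w z) \<in> M"
  proof (rule positive_on_K_imp_M)
    show "(\<lambda>z. z (n + m - 1) - w z) \<in> polys N"
      using w polys_mono[of n N] m by (intro closed polys_coordinate) auto
    fix z assume z: "z \<in> K"
    have "w z = w (restrict z {..<n})" using w by (rule polys_cong) auto
    also have "\<dots> < a (restrict z {..<n})" by (rule less[OF restrict_K_in_Qbox[OF z]])
    also have "\<dots> = z (n + m - 1)" using abscissa_on_K[OF z] abscissa_cong[of "restrict z {..<n}" z] by auto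
    finally show "z (n + m - 1) - w z > 0" by simp
  qed
  then obtain d2 where d2: "certified d2 (\<lambda>z. z (n + m - 1) - w z)" by (auto simp: M_def)
  show ?thesis
  proof
    fix d assume d: "max d2 (nat k) \<le> d"
    then have "poly_fun n (2 * int d) w" using poly_fun_weaken[OF k order_refl, of "2 * int d"] by auto
    then show "feasible n m p d w" using certified_weaken[OF d2, of d] d by (auto simp: feasible_iff_certified)
  qed
qed

lemma feasible_integrable: "feasible n m p d w \<Longrightarrow> set_integrable (Leb n) (Qbox n) w"
  by (rule continuous_on_Qbox_integrable, rule polys_continuous[of _ n])
     (auto simp: feasible_def polys_def)

text \<open>The real \<open>Sup\<close> in \<open>rho\<close> is an upper bound only for a set
  bounded above; the integral of the abscissa supplies that bound.\<close>

lemma feasible_integral_le_rho: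
  assumes w: "feasible n m p d w"
  shows "(LINT q:Qbox n|Leb n. w q) \<le> rho n m p d"
  unfolding rho_def
proof (rule cSup_upper)
  show "(LINT q:Qbox n|Leb n. w q) \<in> {(LINT q:Qbox n|Leb n. w q) |w. feasible n m p d w}" using w by blast
  have "(LINT q:Qbox n|Leb n. v q) \<le> (LINT q:Qbox n|Leb n. a q)" if "feasible n m p d v" for v
    by (rule set_integral_mono[OF feasible_integrable[OF that] continuous_on_Qbox_integrable[OF abscissa_continuous]])
       (rule feasible_le_abscissa[OF that])
  then show "bdd_above {(LINT q:Qbox n|Leb n. w q) |w. feasible n m p d w}" by (auto simp: bdd_above_def)
qed

lemma rho_lower_bound:
  assumes e: "e > 0"
  obtains d1 where "\<And>d. d \<ge> d1 \<Longrightarrow> (LINT q:Qbox n|Leb n. a q) - e \<le> rho n m p d"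
proof -
  define V where "V = measure (Leb n) (Qbox n)"
  \<comment> \<open>The approximant will satisfy \<open>a - 3 * \<delta> < w < a - \<delta>\<close>
    on the box, at a cost of at most \<open>3 * \<delta> * V\<close> in the integral. The
    \<open>+ 1\<close> keeps the denominator positive whatever the volume.\<close>
  define \<delta> where "\<delta> = e / (3 * (V + 1))"
  have V: "V \<ge> 0" by (simp add: V_def)
  have \<delta>: "\<delta> > 0" using e V by (simp add: \<delta>_def)
  have "continuous_on (Qbox n) (\<lambda>q. a q - 2 * \<delta>)" by (intro continuous_intros abscissa_continuous)
  from polys_dense[OF this \<delta>] obtain w where w: "w \<in> polys n" "\<And>q. q \<in> Qbox n \<Longrightarrow> \<bar>a q - 2 * \<delta> - w q\<bar> < \<delta>" by blast
  then have "w q < a q" if "q \<in> Qbox n" for q using w(2)[OF that] \<delta> by linarith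
  from below_abscissa_feasible[OF w(1) this] obtain d1 where d1: "\<And>d. d \<ge> d1 \<Longrightarrow> feasible n m p d w" by blast
  have ia: "set_integrable (Leb n) (Qbox n) a" by (rule continuous_on_Qbox_integrable[OF abscissa_continuous])
  have ic: "set_integrable (Leb n) (Qbox n) (\<lambda>_. 3 * \<delta>)" by (intro continuous_on_Qbox_integrable continuous_intros)
  have "(LINT q:Qbox n|Leb n. a q - 3 * \<delta>) \<le> (LINT q:Qbox n|Leb n. w q)"
  proof (rule set_integral_mono)
    show "set_integrable (Leb n) (Qbox n) (\<lambda>q. a q - 3 * \<delta>)" using ia ic by (rule set_integral_diff)
    show "set_integrable (Leb n) (Qbox n) w" using feasible_integrable[OF d1[OF order_refl]] .
    fix q assume "q \<in> Qbox n"
    then show "a q - 3 * \<delta> \<le> w q" using w(2)[of q] by linarith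
  qed
  moreover have "(LINT q:Qbox n|Leb n. a q - 3 * \<delta>) = (LINT q:Qbox n|Leb n. a q) - 3 * \<delta> * V"
    using set_integral_diff(2)[OF ia ic] sets_Qbox emeasure_Qbox_finite[of n]
    by (simp add: V_def set_lebesgue_integral_def mult.commute)
  moreover have "3 * \<delta> * V \<le> e"
  proof -
    have "3 * \<delta> * V \<le> 3 * \<delta> * (V + 1)" using \<delta> by simp
    also have "\<dots> = e" using V by (simp add: \<delta>_def add_nonneg_eq_0_iff divide_simps)
    finally show ?thesis .
  qed
  ultimately have "(LINT q:Qbox n|Leb n. a q) - e \<le> (LINT q:Qbox n|Leb n. w q)" by linarith
  then show ?thesis using that feasible_integral_le_rho[OF d1] by (meson order_trans)
qed

text \<open>As \<open>w \<le> a\<close> on the box, the absolute value has a fixed sign there and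
  the distance is a gap between integrals.\<close>

lemma L1_distance_feasible:
  assumes w: "feasible n m p d w"
  shows "(\<integral>\<^sup>+ q\<in>Qbox n. ennreal \<bar>w q - a q\<bar> \<partial>Leb n) =
    ennreal ((LINT q:Qbox n|Leb n. a q) - (LINT q:Qbox n|Leb n. w q))"
proof -
  have ia: "set_integrable (Leb n) (Qbox n) a" by (rule continuous_on_Qbox_integrable[OF abscissa_continuous])
  have iw: "set_integrable (Leb n) (Qbox n) w" by (rule feasible_integrable[OF w])
  have i: "integrable (Leb n) (\<lambda>q. indicator (Qbox n) q *\<^sub>R (a q - w q))"
    using set_integral_diff(1)[OF ia iw] by (simp add: set_integrable_def)
  have le: "w q \<le> a q" if "q \<in> Qbox n" for q by (rule feasible_le_abscissa[OF w that])
  have "(\<integral>\<^sup>+ q\<in>Qbox n. ennreal \<bar>w q - a q\<bar> \<partial>Leb n) =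
      (\<integral>\<^sup>+ q. ennreal (indicator (Qbox n) q *\<^sub>R (a q - w q)) \<partial>Leb n)"
    using le by (intro nn_integral_cong) (auto simp: indicator_def)
  also have "\<dots> = ennreal (\<integral>q. indicator (Qbox n) q *\<^sub>R (a q - w q) \<partial>Leb n)"
    using i le by (intro nn_integral_eq_integral) (auto simp: indicator_def)
  also have "(\<integral>q. indicator (Qbox n) q *\<^sub>R (a q - w q) \<partial>Leb n) =
      (LINT q:Qbox n|Leb n. a q) - (LINT q:Qbox n|Leb n. w q)"
    using set_integral_diff(2)[OF ia iw] by (simp add: set_lebesgue_integral_def)
  finally show ?thesis .
qed

end

theorem theorem2:
  fixes n m d0 :: nat
    and p :: "nat \<Rightarrow> (nat \<Rightarrow> real) \<Rightarrow> real"
    and w :: "nat \<Rightarrow> (nat \<Rightarrow> real) \<Rightarrow> real"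
  assumes "n \<ge> 1" and "m \<ge> 1"
    and "\<forall>k<m. \<exists>e. poly_fun n e (p k)"
    and "p m = (\<lambda>_. 1)"
    and "\<forall>d\<ge>d0. \<exists>v. feasible n m p d v"
    and "\<forall>d\<ge>d0. feasible n m p d (w d) \<and>
                 (LINT q:Qbox n|Leb n. w d q) \<ge> rho n m p d - 1 / real d"
  shows "(\<forall>d\<ge>d0. \<forall>q\<in>Qbox n. w d q \<le> abscissa m p q) \<and>
         ((\<lambda>d. \<integral>\<^sup>+ q\<in>Qbox n. ennreal \<bar>w d q - abscissa m p q\<bar> \<partial>Leb n) \<longlonglongrightarrow> 0)"
proof
  interpret abscissa_program n m p
    using assms by unfold_locales (auto simp: polys_def)
  have w: "feasible n m p d (w d)" and near: "(LINT q:Qbox n|Leb n. w d q) \<ge> rho n m p d - 1 / real d"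
    if "d \<ge> d0" for d using assms(6) that by auto
  show "\<forall>d\<ge>d0. \<forall>q\<in>Qbox n. w d q \<le> a q" using feasible_le_abscissa w by blast
  define r where "r d = (LINT q:Qbox n|Leb n. a q) - (LINT q:Qbox n|Leb n. w d q)" for d
  have "r \<longlonglongrightarrow> 0"
  proof (rule LIMSEQ_I)
    fix e :: real assume e: "e > 0"
    then obtain d1 where d1: "\<And>d. d \<ge> d1 \<Longrightarrow> (LINT q:Qbox n|Leb n. a q) - e / 2 \<le> rho n m p d"
      using rho_lower_bound[of "e / 2"] by auto
    \<comment> \<open>Half of \<open>e\<close> pays for the gap between the integral of
      \<open>a\<close> and \<open>rho\<close>, the other half for the near-optimality slack
      \<open>1 / real d\<close>.\<close>
    obtain d2 :: nat where d2: "real d2 > 2 / e" using reals_Archimedean2 by blast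
    show "\<exists>no. \<forall>d\<ge>no. norm (r d - 0) < e"
    proof (intro exI allI impI)
      fix d assume d: "max d0 (max d1 d2) \<le> d"
      then have "real d \<ge> real d2" by simp
      then have "real d > 2 / e" using d2 by linarith
      moreover have "2 / e > 0" using e by simp
      ultimately have "real d > 0" "real d > 2 / e" by linarith+
      then have "1 / real d < e / 2" using e by (simp add: field_simps)
      moreover have "r d \<ge> 0" unfolding r_def
        using set_integral_mono[OF feasible_integrable[OF w] continuous_on_Qbox_integrable[OF abscissa_continuous],
            of d] feasible_le_abscissa[OF w, of d] d by simp
      moreover have "r d \<le> e / 2 + 1 / real d" unfolding r_def using near[of d] d1[of d] d by simp
      ultimately show "norm (r d - 0) < e" by simp
    qed
  qed
  then have "(\<lambda>d. ennreal (r d)) \<longlonglongrightarrow> 0" using tendsto_ennrealI by fastforce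
  \<comment> \<open>The identity of \<open>L1_distance_feasible\<close> is available from
    \<open>d0\<close> on, where \<open>w d\<close> is feasible.\<close>
  moreover have "\<forall>\<^sub>F d in sequentially. ennreal (r d) = (\<integral>\<^sup>+ q\<in>Qbox n. ennreal \<bar>w d q - a q\<bar> \<partial>Leb n)"
    using eventually_ge_at_top[of d0] by eventually_elim (simp add: r_def L1_distance_feasible[OF w])
  ultimately show "(\<lambda>d. \<integral>\<^sup>+ q\<in>Qbox n. ennreal \<bar>w d q - a q\<bar> \<partial>Leb n) \<longlonglongrightarrow> 0"
    by (rule Lim_transform_eventually)
qed

end
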